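(* Suppose the distributed stochastic optimization problem (P) described in the context is feasible. Then under the drift-plus-penalty algorithm (described in the context) with parameter $V$: (1) For any $V\ge 0$, all desired constraints are satisfied: $\limsup_{t\to\infty}\frac1t\sum_{\tau=0}^{t-1}\mathbb{E}[p_k(\tau)]\le c_k$ for all $k\in\{1,\dots,K\}$, and the algorithm is distributed. (2) For any $V>0$ and all $t>0$, $$\frac1t\sum_{\tau=0}^{t-1}\mathbb{E}[p_0(\tau)]\le p_0^{opt}+\frac{B(1+2D)}{V}+\frac{\mathbb{E}[L(D)]}{Vt}.$$ (3) For all $k\in\{1,\dots,K\}$ and all $t>0$, $$\frac1t\sum_{\tau=0}^{t-1}\mathbb{E}[p_k(\tau)]\le c_k+O(\sqrt{V/t}),$$ meaning: for each $V_0>0$ there is a constant $\Gamma$, independent of $t$ and $V$, such that for all $V\ge V_0$, all $t\in\{1,2,\dots\}$ and all $k\in\{1,\dots,K\}$ the left-hand side is at most $c_k+\Gamma\sqrt{V/t}$.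
   Context: Setting. There are $N$ users and slots $t\in\{0,1,2,\dots\}$. $\Omega=\Omega_1\times\cdots\times\Omega_N$ and $\mathcal{A}=\mathcal{A}_1\times\cdots\times\mathcal{A}_N$ are products of finite nonempty sets. The random event vectors $\boldsymbol{\omega}(t)=(\omega_1(t),\dots,\omega_N(t))\in\Omega$ are i.i.d. over slots, with $\pi(\boldsymbol{\omega})=Pr[\boldsymbol{\omega}(t)=\boldsymbol{\omega}]$. Actions are $\boldsymbol{\alpha}(t)\in\mathcal{A}$. For $k\in\{0,\dots,K\}$, $\hat p_k:\mathcal{A}\times\Omega\to\mathbb{R}$ are given functions, $p_k(t)=\hat p_k(\boldsymbol{\alpha}(t),\boldsymbol{\omega}(t))$, and $c_1,\dots,c_K$ are given reals. Distributed algorithm. An algorithm is distributed if there are an abstract set $\mathcal{X}$, random elements $X(t)\in\mathcal{X}$ with $\boldsymbol{\omega}(t)$ independent of $X(t)$ for each $t$, and deterministic functions $f_i:\Omega_i\times\mathcal{X}\to\mathcal{A}_i$ such that $\alpha_i(t)=f_i(\omega_i(t),X(t))$ for all $i\in\{1,\dots,N\}$ and all $t$. Problem (P). Minimize $\limsup_{t\to\infty}\frac1t\sum_{\tau=0}^{t-1}\mathbb{E}[p_0(\tau)]$ over distributed algorithms subject to $\limsup_{t\to\infty}\frac1t\sum_{\tau=0}^{t-1}\mathbb{E}[p_k(\tau)]\le c_k$ for all $k\in\{1,\dots,K\}$. It is feasible if some distributed algorithm satisfies the constraints; $p_0^{opt}$ denotes the infimum of the objective over distributed algorithms satisfying the constraints.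 Pure strategies. A pure strategy is $\boldsymbol{g}(\boldsymbol{\omega})=(g_1(\omega_1),\dots,g_N(\omega_N))$ with $g_i:\Omega_i\to\mathcal{A}_i$. All $M=\prod_i|\mathcal{A}_i|^{|\Omega_i|}$ pure strategies are enumerated $\boldsymbol{g}^{(1)},\dots,\boldsymbol{g}^{(M)}$, and $r_k^{(m)}=\sum_{\boldsymbol{\omega}\in\Omega}\pi(\boldsymbol{\omega})\hat p_k(\boldsymbol{g}^{(m)}(\boldsymbol{\omega}),\boldsymbol{\omega})$. Consider the linear program: minimize $\sum_m\theta_m r_0^{(m)}$ subject to $\sum_m\theta_m r_k^{(m)}\le c_k$ for $k=1,\dots,K$, $\theta_m\ge0$, $\sum_m\theta_m=1$. $\tilde M\le M$ is the number of pure strategies required for consideration in this linear program: the enumeration is such that the linear program restricted to $m\in\{1,\dots,\tilde M\}$ has the same optimal value (which, when (P) is feasible, is $p_0^{opt}$) as the full one over $\{1,\dots,M\}$. One may take $\tilde M=M$. Virtual queues. $D$ is a non-negative integer (feedback delay). For $k\in\{1,\dots,K\}$, $Q_k(0)\ge 0$ is a fixed commonly known value and $$Q_k(t+1)=\max[Q_k(t)+p_k(t-D)-c_k,\,0],\qquad t\in\{0,1,2,\dots\},$$ with $p_k(-1)=\cdots=p_k(-D)=0$ if $D>0$. $\boldsymbol{Q}(t)=(Q_1(t),\dots,Q_K(t))$ and $L(t)=\frac12\sum_{k=1}^K Q_k(t)^2$. Drift-plus-penalty algorithm with parameter $V\ge0$. On every slot $t$, users observe $\boldsymbol{Q}(t)$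 and use $\boldsymbol{\alpha}(t)=\boldsymbol{g}^{(m)}(\boldsymbol{\omega}(t))$, where $m\in\{1,\dots,\tilde M\}$ minimizes $Vr_0^{(m)}+\sum_{k=1}^K Q_k(t)r_k^{(m)}$ (ties broken arbitrarily); then the queues are updated by $Q_k(t+1)=\max[Q_k(t)+p_k(t-D)-c_k,\,0]$ for all $k\in\{1,\dots,K\}$. Constant: $B=\max_{m\in\{1,\dots,\tilde M\}}\frac12\sum_{k=1}^K\sum_{\boldsymbol{\omega}\in\Omega}\pi(\boldsymbol{\omega})\left|\hat p_k(\boldsymbol{g}^{(m)}(\boldsymbol{\omega}),\boldsymbol{\omega})-c_k\right|^2$.
   Formalization: In (2), E[L(D)] is replaced by E[L(D)] + S, with S = √(2B)·Σ_{j<D} max(0, ‖Q(D)−Q(j)‖ − (D−j)√(2B)), a constant independent of V and t; as written (2) fails for some D ≥ 1. S = 0 if D = 0, or if Q(0) = 0 and all c_k ≥ 0. *)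

theory Defs
  imports "HOL-Probability.Probability"
begin

section \<open>Problem data\<close>

text \<open>
  Users are numbered \<open>1..n_users\<close>, constraints \<open>1..n_constraints\<close>; penalty index \<open>0\<close> is the
  objective. Vectors over the users are extensional functions on \<open>{1..n_users}\<close>.
\<close>

record ('w, 'a) scheduling_problem =
  n_users :: nat
  n_constraints :: nat
  event_set :: "nat \<Rightarrow> 'w set"
  action_set :: "nat \<Rightarrow> 'a set"
  event_prob :: "(nat \<Rightarrow> 'w) \<Rightarrow> real"
  penalty :: "nat \<Rightarrow> (nat \<Rightarrow> 'a) \<Rightarrow> (nat \<Rightarrow> 'w) \<Rightarrow> real"
  target :: "nat \<Rightarrow> real"

definition event_vectors :: "('w, 'a) scheduling_problem \<Rightarrow> (nat \<Rightarrow> 'w) set" where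
  "event_vectors P = PiE {1..n_users P} (event_set P)"

definition finite_alphabets :: "('w, 'a) scheduling_problem \<Rightarrow> bool" where
  "finite_alphabets P \<longleftrightarrow>
     (\<forall>i\<in>{1..n_users P}. finite (event_set P i) \<and> event_set P i \<noteq> {} \<and>
                         finite (action_set P i) \<and> action_set P i \<noteq> {})"

definition iid_events ::
  "'s measure \<Rightarrow> ('w, 'a) scheduling_problem \<Rightarrow> (nat \<Rightarrow> 's \<Rightarrow> nat \<Rightarrow> 'w) \<Rightarrow> bool" where
  "iid_events M P \<omega> \<longleftrightarrow>
     prob_space M \<and>
     prob_space.indep_vars M (\<lambda>_. count_space (event_vectors P)) \<omega> UNIV \<and>
     (\<forall>t. \<forall>w\<in>event_vectors P. measure M {s \<in> space M. \<omega> t s = w} = event_prob P w)"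

section \<open>Independence of two random elements\<close>

text \<open>\<^const>\<open>prob_space.indep_var\<close> only relates random variables of the same type.\<close>

definition indep_rv ::
  "'s measure \<Rightarrow> 'b measure \<Rightarrow> ('s \<Rightarrow> 'b) \<Rightarrow> 'c measure \<Rightarrow> ('s \<Rightarrow> 'c) \<Rightarrow> bool" where
  "indep_rv M N X N' Y \<longleftrightarrow>
     X \<in> M \<rightarrow>\<^sub>M N \<and> Y \<in> M \<rightarrow>\<^sub>M N' \<and>
     prob_space.indep_set M {X -` A \<inter> space M |A. A \<in> sets N} {Y -` B \<inter> space M |B. B \<in> sets N'}"

lemma (in prob_space) indep_rv_iff_indep_var: "indep_rv M N X N' Y \<longleftrightarrow> indep_var N X N' Y"
proof (cases "X \<in> M \<rightarrow>\<^sub>M N \<and> Y \<in> M \<rightarrow>\<^sub>M N'")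
  case True
  have "sigma_sets (space M) {X -` A \<inter> space M |A. A \<in> sets N} = {X -` A \<inter> space M |A. A \<in> sets N}"
    if "X \<in> M \<rightarrow>\<^sub>M N" for X :: "'a \<Rightarrow> 'b" and N
  proof -
    have "X \<in> space M \<rightarrow> space N" using that by (auto dest: measurable_space)
    from sets_vimage_algebra2[OF this] show ?thesis
      using sets.sigma_sets_eq[of "vimage_algebra (space M) X N"] by simp
  qed
  then show ?thesis
    using True by (auto simp: indep_rv_def indep_var_eq)
qed (auto simp: indep_rv_def indep_var_eq)

section \<open>Distributed algorithms and the optimal value\<close>

text \<open>
  The sets of actions and event vectors are finite, so for measurable \<open>\<alpha>\<close> and \<open>\<omega>\<close> all the
  expectations below are expectations of simple functions.
\<close>

definition avg_penalty ::
  "'s measure \<Rightarrow> ('w, 'a) scheduling_problem \<Rightarrow> (nat \<Rightarrow> 's \<Rightarrow> nat \<Rightarrow> 'w) \<Rightarrow>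
   (nat \<Rightarrow> 's \<Rightarrow> nat \<Rightarrow> 'a) \<Rightarrow> nat \<Rightarrow> nat \<Rightarrow> real" where
  "avg_penalty M P \<omega> \<alpha> k t =
     (1 / real t) * (\<Sum>\<tau><t. \<integral>s. penalty P k (\<alpha> \<tau> s) (\<omega> \<tau> s) \<partial>M)"

text \<open>
  The abstract set of the common information is the space of an arbitrary measurable space over
  \<open>'x\<close>. Measurability of \<open>f i w\<close> is what makes the independence of \<open>\<omega> t\<close> and \<open>X t\<close> effective;
  it is automatic for a discrete space.
\<close>

definition distributed_alg ::
  "'x itself \<Rightarrow> 's measure \<Rightarrow> ('w, 'a) scheduling_problem \<Rightarrow> (nat \<Rightarrow> 's \<Rightarrow> nat \<Rightarrow> 'w) \<Rightarrow>
   (nat \<Rightarrow> 's \<Rightarrow> nat \<Rightarrow> 'a) \<Rightarrow> bool" where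
  "distributed_alg tx M P \<omega> \<alpha> \<longleftrightarrow>
     (\<exists>(\<X> :: 'x measure) (X :: nat \<Rightarrow> 's \<Rightarrow> 'x) (f :: nat \<Rightarrow> 'w \<Rightarrow> 'x \<Rightarrow> 'a).
        (\<forall>t. indep_rv M (count_space (event_vectors P)) (\<omega> t) \<X> (X t)) \<and>
        (\<forall>i\<in>{1..n_users P}. \<forall>w\<in>event_set P i. f i w \<in> \<X> \<rightarrow>\<^sub>M count_space (action_set P i)) \<and>
        (\<forall>t. \<forall>s\<in>space M. \<alpha> t s = (\<lambda>i\<in>{1..n_users P}. f i (\<omega> t s i) (X t s))))"

definition meets_constraints ::
  "'s measure \<Rightarrow> ('w, 'a) scheduling_problem \<Rightarrow> (nat \<Rightarrow> 's \<Rightarrow> nat \<Rightarrow> 'w) \<Rightarrow>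
   (nat \<Rightarrow> 's \<Rightarrow> nat \<Rightarrow> 'a) \<Rightarrow> bool" where
  "meets_constraints M P \<omega> \<alpha> \<longleftrightarrow>
     (\<forall>k\<in>{1..n_constraints P}.
        limsup (\<lambda>t. ereal (avg_penalty M P \<omega> \<alpha> k t)) \<le> ereal (target P k))"

definition feasible_problem ::
  "'x itself \<Rightarrow> 's measure \<Rightarrow> ('w, 'a) scheduling_problem \<Rightarrow> (nat \<Rightarrow> 's \<Rightarrow> nat \<Rightarrow> 'w) \<Rightarrow> bool" where
  "feasible_problem tx M P \<omega> \<longleftrightarrow>
     (\<exists>\<alpha>. distributed_alg tx M P \<omega> \<alpha> \<and> meets_constraints M P \<omega> \<alpha>)"

definition p0_opt ::
  "'x itself \<Rightarrow> 's measure \<Rightarrow> ('w, 'a) scheduling_problem \<Rightarrow> (nat \<Rightarrow> 's \<Rightarrow> nat \<Rightarrow> 'w) \<Rightarrow> ereal" where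
  "p0_opt tx M P \<omega> =
     (INF \<alpha>\<in>{\<alpha>. distributed_alg tx M P \<omega> \<alpha> \<and> meets_constraints M P \<omega> \<alpha>}.
        limsup (\<lambda>t. ereal (avg_penalty M P \<omega> \<alpha> 0 t)))"

section \<open>Pure strategies and the linear program\<close>

definition pure_strategies :: "('w, 'a) scheduling_problem \<Rightarrow> (nat \<Rightarrow> 'w \<Rightarrow> 'a) set" where
  "pure_strategies P = (\<Pi>\<^sub>E i\<in>{1..n_users P}. event_set P i \<rightarrow>\<^sub>E action_set P i)"

definition n_strategies :: "('w, 'a) scheduling_problem \<Rightarrow> nat" where
  "n_strategies P = (\<Prod>i=1..n_users P. card (action_set P i) ^ card (event_set P i))"

definition apply_strategy ::
  "('w, 'a) scheduling_problem \<Rightarrow> (nat \<Rightarrow> 'w \<Rightarrow> 'a) \<Rightarrow> (nat \<Rightarrow> 'w) \<Rightarrow> (nat \<Rightarrow> 'a)" where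
  "apply_strategy P g w = (\<lambda>i\<in>{1..n_users P}. g i (w i))"

definition strategy_penalty ::
  "('w, 'a) scheduling_problem \<Rightarrow> nat \<Rightarrow> (nat \<Rightarrow> 'w \<Rightarrow> 'a) \<Rightarrow> real" where
  "strategy_penalty P k g =
     (\<Sum>w\<in>event_vectors P. event_prob P w * penalty P k (apply_strategy P g w) w)"

definition lp_feasible ::
  "('w, 'a) scheduling_problem \<Rightarrow> (nat \<Rightarrow> nat \<Rightarrow> 'w \<Rightarrow> 'a) \<Rightarrow> nat \<Rightarrow> (nat \<Rightarrow> real) set" where
  "lp_feasible P g n =
     {\<theta>. (\<forall>m\<in>{1..n}. \<theta> m \<ge> 0) \<and> (\<Sum>m=1..n. \<theta> m) = 1 \<and>
         (\<forall>k\<in>{1..n_constraints P}. (\<Sum>m=1..n. \<theta> m * strategy_penalty P k (g m)) \<le> target P k)}"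

text \<open>The value is \<open>\<infinity>\<close> for an infeasible program.\<close>

definition lp_value ::
  "('w, 'a) scheduling_problem \<Rightarrow> (nat \<Rightarrow> nat \<Rightarrow> 'w \<Rightarrow> 'a) \<Rightarrow> nat \<Rightarrow> ereal" where
  "lp_value P g n =
     (INF \<theta>\<in>lp_feasible P g n. ereal (\<Sum>m=1..n. \<theta> m * strategy_penalty P 0 (g m)))"

definition strategy_enumeration ::
  "('w, 'a) scheduling_problem \<Rightarrow> (nat \<Rightarrow> nat \<Rightarrow> 'w \<Rightarrow> 'a) \<Rightarrow> nat \<Rightarrow> bool" where
  "strategy_enumeration P g Mt \<longleftrightarrow>
     bij_betw g {1..n_strategies P} (pure_strategies P) \<and>
     Mt \<le> n_strategies P \<and> lp_value P g Mt = lp_value P g (n_strategies P)"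

section \<open>Virtual queues and the drift-plus-penalty algorithm\<close>

primrec queue_rec :: "nat \<Rightarrow> real \<Rightarrow> real \<Rightarrow> (nat \<Rightarrow> real) \<Rightarrow> nat \<Rightarrow> real" where
  "queue_rec D c q p 0 = q"
| "queue_rec D c q p (Suc t) =
     max (queue_rec D c q p t + (if D \<le> t then p (t - D) else 0) - c) 0"

definition virtual_queue ::
  "('w, 'a) scheduling_problem \<Rightarrow> nat \<Rightarrow> (nat \<Rightarrow> real) \<Rightarrow> (nat \<Rightarrow> 's \<Rightarrow> nat \<Rightarrow> 'w) \<Rightarrow>
   (nat \<Rightarrow> 's \<Rightarrow> nat \<Rightarrow> 'a) \<Rightarrow> nat \<Rightarrow> nat \<Rightarrow> 's \<Rightarrow> real" where
  "virtual_queue P D Q0 \<omega> \<alpha> k t s =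
     queue_rec D (target P k) (Q0 k) (\<lambda>\<tau>. penalty P k (\<alpha> \<tau> s) (\<omega> \<tau> s)) t"

definition lyapunov ::
  "('w, 'a) scheduling_problem \<Rightarrow> nat \<Rightarrow> (nat \<Rightarrow> real) \<Rightarrow> (nat \<Rightarrow> 's \<Rightarrow> nat \<Rightarrow> 'w) \<Rightarrow>
   (nat \<Rightarrow> 's \<Rightarrow> nat \<Rightarrow> 'a) \<Rightarrow> nat \<Rightarrow> 's \<Rightarrow> real" where
  "lyapunov P D Q0 \<omega> \<alpha> t s =
     (1/2) * (\<Sum>k=1..n_constraints P. (virtual_queue P D Q0 \<omega> \<alpha> k t s)\<^sup>2)"

text \<open>
  \<open>\<alpha>\<close> is a run of the algorithm if it is generated by some sequence \<open>m\<close> of commonly known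
  strategy indices. Ties are broken arbitrarily, possibly at random and depending on the past,
  but causally: \<open>\<omega> t\<close> is independent of the earlier events together with the choices made up to
  and including slot \<open>t\<close>. For i.i.d. events this is automatic when \<open>m t\<close> is determined by \<open>t\<close>
  and the queues at time \<open>t\<close>. It also comprises the measurability of \<open>m\<close>.
\<close>

definition drift_plus_penalty ::
  "'s measure \<Rightarrow> ('w, 'a) scheduling_problem \<Rightarrow> (nat \<Rightarrow> 's \<Rightarrow> nat \<Rightarrow> 'w) \<Rightarrow>
   (nat \<Rightarrow> nat \<Rightarrow> 'w \<Rightarrow> 'a) \<Rightarrow> nat \<Rightarrow> nat \<Rightarrow> (nat \<Rightarrow> real) \<Rightarrow> real \<Rightarrow>
   (nat \<Rightarrow> 's \<Rightarrow> nat \<Rightarrow> 'a) \<Rightarrow> bool" where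
  "drift_plus_penalty M P \<omega> g Mt D Q0 V \<alpha> \<longleftrightarrow>
     (\<exists>m :: nat \<Rightarrow> 's \<Rightarrow> nat.
        (\<forall>t. \<forall>s\<in>space M.
           is_arg_min
             (\<lambda>j. V * strategy_penalty P 0 (g j) +
                  (\<Sum>k=1..n_constraints P.
                     virtual_queue P D Q0 \<omega> \<alpha> k t s * strategy_penalty P k (g j)))
             (\<lambda>j. j \<in> {1..Mt}) (m t s) \<and>
           \<alpha> t s = apply_strategy P (g (m t s)) (\<omega> t s)) \<and>
        (\<forall>t. indep_rv M
           (count_space (event_vectors P)) (\<omega> t)
           (PiM {..<t} (\<lambda>_. count_space (event_vectors P)) \<Otimes>\<^sub>M
            PiM {..t} (\<lambda>_. count_space {1..Mt}))
           (\<lambda>s. (\<lambda>\<tau>\<in>{..<t}. \<omega> \<tau> s, \<lambda>\<tau>\<in>{..t}. m \<tau> s))))"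

definition drift_const ::
  "('w, 'a) scheduling_problem \<Rightarrow> (nat \<Rightarrow> nat \<Rightarrow> 'w \<Rightarrow> 'a) \<Rightarrow> nat \<Rightarrow> real" where
  "drift_const P g Mt =
     (MAX m\<in>{1..Mt}. (1/2) * (\<Sum>k=1..n_constraints P. \<Sum>w\<in>event_vectors P.
        event_prob P w * \<bar>penalty P k (apply_strategy P (g m) w) w - target P k\<bar>\<^sup>2))"

section \<open>The initial transient for positive delay\<close>

text \<open>
  During the first \<open>D\<close> slots the queues are fed with the fictitious penalties \<open>0\<close> and hence are
  deterministic.
\<close>

lemma queue_rec_startup: "t \<le> D \<Longrightarrow> queue_rec D c q p t = queue_rec D c q p' t"
  by (induction t) auto

text \<open>
  The constant \<open>B\<close> bounds half the mean squared change of the queue vector only in slots fed with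
  genuine penalties; the changes in slots \<open>0..<D\<close>, where \<open>Q k\<close> moves by \<open>- c k\<close> (truncated), can
  be arbitrarily larger. Then the bound with error term \<open>B (1 + 2 D) / V + E L(D) / (V t)\<close> fails:
  take one user, one event, \<open>K = 1\<close>, \<open>D = 1\<close>, \<open>c = Q(0) = 1000\<close>, \<open>V = 900\<close> and two actions with
  \<open>(p 0, p 1)\<close> equal to \<open>(0, 1000)\<close> and \<open>(1, 999)\<close>. The optimal value is \<open>0\<close>, \<open>B = 1/2\<close> and
  \<open>L(1) = 0\<close>, but in slot \<open>0\<close> the second action is used, so that the average of \<open>p 0\<close> at
  \<open>t = 1\<close> is \<open>1\<close>, while the bound is \<open>1/600\<close>. The following quantity accounts for the part of
  the queue displacement between slots \<open>j < D\<close> and \<open>D\<close> which exceeds what \<open>B\<close> allows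
  for, namely \<open>sqrt (2 B)\<close> per slot. It vanishes if no such excess occurs.
\<close>

definition startup_excess ::
  "('w, 'a) scheduling_problem \<Rightarrow> nat \<Rightarrow> (nat \<Rightarrow> real) \<Rightarrow> real \<Rightarrow> real" where
  "startup_excess P D Q0 B =
     (let Q = (\<lambda>j k. queue_rec D (target P k) (Q0 k) (\<lambda>_. 0) j) in
      sqrt (2 * B) *
      (\<Sum>j<D. max 0 (L2_set (\<lambda>k. Q D k - Q j k) {1..n_constraints P} - real (D - j) * sqrt (2 * B))))"

lemma startup_excess_no_delay: "startup_excess P 0 Q0 B = 0"
  by (simp add: startup_excess_def)

lemma startup_excess_small_steps:
  assumes "B \<ge> 0"
    and step: "\<And>j. j < D \<Longrightarrow>
      (1/2) * (\<Sum>k=1..n_constraints P.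
         (queue_rec D (target P k) (Q0 k) (\<lambda>_. 0) (Suc j) -
          queue_rec D (target P k) (Q0 k) (\<lambda>_. 0) j)\<^sup>2) \<le> B"
  shows "startup_excess P D Q0 B = 0"
proof -
  define Q where "Q j k = queue_rec D (target P k) (Q0 k) (\<lambda>_. 0) j" for j k
  let ?K = "{1..n_constraints P}"
  have one: "L2_set (\<lambda>k. Q (Suc j) k - Q j k) ?K \<le> sqrt (2 * B)" if "j < D" for j
    unfolding L2_set_def using step[OF that] by (simp add: Q_def)
  have "L2_set (\<lambda>k. Q (D - n + n) k - Q (D - n) k) ?K \<le> real n * sqrt (2 * B)" if "n \<le> D" for n
    using that
  proof (induction n)
    case (Suc n)
    have e: "Suc (D - Suc n) = D - n" and "n \<le> D" "D - Suc n < D"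
      using Suc.prems by auto
    have "L2_set (\<lambda>k. Q D k - Q (D - Suc n) k) ?K
        = L2_set (\<lambda>k. (Q D k - Q (D - n) k) + (Q (Suc (D - Suc n)) k - Q (D - Suc n) k)) ?K"
      by (simp add: e)
    also have "\<dots> \<le> L2_set (\<lambda>k. Q D k - Q (D - n) k) ?K
        + L2_set (\<lambda>k. Q (Suc (D - Suc n)) k - Q (D - Suc n) k) ?K"
      by (rule L2_set_triangle_ineq)
    also have "\<dots> \<le> real n * sqrt (2 * B) + sqrt (2 * B)"
      using Suc.IH[OF \<open>n \<le> D\<close>] one[OF \<open>D - Suc n < D\<close>] \<open>n \<le> D\<close> by auto
    finally show ?case using Suc.prems by (simp add: algebra_simps)
  qed (simp add: L2_set_def)
  note * = this
  have "L2_set (\<lambda>k. Q D k - Q j k) ?K \<le> real (D - j) * sqrt (2 * B)" if "j < D" for j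
    using *[of "D - j"] that by simp
  then have "(\<Sum>j<D. max 0 (L2_set (\<lambda>k. Q D k - Q j k) ?K - real (D - j) * sqrt (2 * B))) = 0"
    by (intro sum.neutral ballI) (meson diff_le_0_iff_le lessThan_iff max_absorb1)
  then show ?thesis by (simp add: startup_excess_def Q_def)
qed

lemma startup_excess_zero_queues:
  assumes "B \<ge> 0" "\<And>k. k \<in> {1..n_constraints P} \<Longrightarrow> Q0 k = 0 \<and> target P k \<ge> 0"
  shows "startup_excess P D Q0 B = 0"
proof (rule startup_excess_small_steps[OF assms(1)])
  fix j
  have "queue_rec D (target P k) (Q0 k) (\<lambda>_. 0) j = 0" if "k \<in> {1..n_constraints P}" for j k
    using assms(2)[OF that] by (induction j) auto
  then show "(1/2) * (\<Sum>k=1..n_constraints P.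
         (queue_rec D (target P k) (Q0 k) (\<lambda>_. 0) (Suc j) -
          queue_rec D (target P k) (Q0 k) (\<lambda>_. 0) j)\<^sup>2) \<le> B"
    using assms(1) by (simp del: queue_rec.simps)
qed

lemma startup_excess_large_B:
  assumes "B \<ge> (1/2) * (\<Sum>k=1..n_constraints P. (target P k)\<^sup>2)"
    and "\<And>k. k \<in> {1..n_constraints P} \<Longrightarrow> Q0 k \<ge> 0"
  shows "startup_excess P D Q0 B = 0"
proof (rule startup_excess_small_steps)
  have "(0::real) \<le> (1/2) * (\<Sum>k=1..n_constraints P. (target P k)\<^sup>2)"
    by (simp add: sum_nonneg)
  with assms(1) show "B \<ge> 0" by linarith
next
  fix j assume "j < D"
  have nn: "queue_rec D (target P k) (Q0 k) (\<lambda>_. 0) j \<ge> 0" if "k \<in> {1..n_constraints P}" for k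
    using assms(2)[OF that] by (cases j) auto
  have "(queue_rec D (target P k) (Q0 k) (\<lambda>_. 0) (Suc j) -
          queue_rec D (target P k) (Q0 k) (\<lambda>_. 0) j)\<^sup>2 \<le> (target P k)\<^sup>2"
    if "k \<in> {1..n_constraints P}" for k
    using nn[OF that] by (intro abs_le_square_iff[THEN iffD1]) auto
  then have "(\<Sum>k=1..n_constraints P. (queue_rec D (target P k) (Q0 k) (\<lambda>_. 0) (Suc j) -
          queue_rec D (target P k) (Q0 k) (\<lambda>_. 0) j)\<^sup>2) \<le> (\<Sum>k=1..n_constraints P. (target P k)\<^sup>2)"
    by (intro sum_mono)
  then show "(1/2) * (\<Sum>k=1..n_constraints P.
         (queue_rec D (target P k) (Q0 k) (\<lambda>_. 0) (Suc j) -
          queue_rec D (target P k) (Q0 k) (\<lambda>_. 0) j)\<^sup>2) \<le> B"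
    using assms(1) by linarith
qed

end

theory Submission
  imports Defs
begin

text \<open>
  In one slot a distributed algorithm applies a pure strategy chosen at random by the common
  information, which is independent of the current events. Its expected penalties in that slot are
  therefore a mixture of the vectors of strategy penalties, and so are their time averages
  (\<open>avg_penalty_mixture\<close>). The mixture weights live in a compact simplex; a limit point of the
  weights is a feasible point of the linear program whose value is at most the limsup of the
  objective (\<open>lp_feasible_le_limsup\<close>). So the value of the linear program is a lower bound for
  the optimal value, and it suffices to compare the algorithm with a feasible mixture \<open>\<theta>\<close>.

  The comparison is the drift argument for the Lyapunov function \<open>L\<close>. With feedback delay \<open>D\<close> the
  penalties of slot \<open>t\<close> enter the queues in slot \<open>D + t\<close>, so the drift there pairs them with the
  queues \<open>Q (D + t)\<close>, whereas the strategy of slot \<open>t\<close> was chosen for \<open>Q t\<close>. Replacing the one by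
  the other costs the displacement of the queues over \<open>D\<close> slots times the size of the current
  deviation \<open>p - c\<close> (\<open>delayed_drift\<close>). A displacement caused by penalties is at most the sum of the
  deviations in the slots concerned. As the mean square of a deviation is at most \<open>2 B\<close>, so is the
  mean product of two of them; this costs \<open>2 B\<close> per slot of delay, which together with the
  quadratic term \<open>B\<close> of the drift gives \<open>B (1 + 2 D)\<close>. Displacements within the
  first \<open>D\<close> slots are deterministic but may be larger; what they add in total is the startup excess
  (\<open>sum_startup_excess_le\<close>).

  The remaining term of drift plus penalty is, because the current events are independent of the
  history, the mean of the expression which the algorithm minimizes, less the inner product of
  queues and targets. It is therefore at most \<open>V\<close> times the objective of the feasible mixture \<open>\<theta>\<close>
  (\<open>drift_plus_penalty_le_mixture\<close>). Summing over the slots gives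
  \<open>drift_plus_penalty_sum\<close>. Discarding the final Lyapunov value there yields the bound for the
  objective. Bounding the objective crudely instead shows that the mean of \<open>L\<close> grows at most linearly
  with a slope \<open>O(1 + V)\<close>; thus the mean queues are \<open>O(sqrt (t (1 + V)))\<close>, and they dominate the
  accumulated violation of the constraints.
\<close>

section \<open>Finite-valued random elements\<close>

text \<open>
  Events, chosen strategies and all that is computed from them take finitely many values. Working
  with simple functions instead of measurable ones makes every function of them admissible and integrable, without measurability
  conditions on penalties or strategies.
\<close>

lemma simple_function_count_space:
  assumes "f \<in> N \<rightarrow>\<^sub>M count_space A" "finite A"
  shows "simple_function N f"
  unfolding simple_function_def
proof (intro conjI ballI)
  have sub: "f ` space N \<subseteq> A"
    using measurable_space[OF assms(1)] by auto
  then show "finite (f ` space N)"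
    using assms(2) finite_subset by blast
  show "f -` {x} \<inter> space N \<in> sets N" if "x \<in> f ` space N" for x
    using that sub by (intro measurable_sets[OF assms(1)]) auto
qed

lemma simple_function_measurable_comp:
  assumes "Y \<in> M \<rightarrow>\<^sub>M N" "simple_function N f"
  shows "simple_function M (\<lambda>s. f (Y s))"
  unfolding simple_function_def
proof (intro conjI ballI)
  have sub: "(\<lambda>s. f (Y s)) ` space M \<subseteq> f ` space N"
    using measurable_space[OF assms(1)] by auto
  then show "finite ((\<lambda>s. f (Y s)) ` space M)"
    using assms(2) finite_subset unfolding simple_function_def by blast
  fix x assume "x \<in> (\<lambda>s. f (Y s)) ` space M"
  then have "f -` {x} \<inter> space N \<in> sets N"
    using sub assms(2) unfolding simple_function_def by blast
  then have "Y -` (f -` {x} \<inter> space N) \<inter> space M \<in> sets M"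
    by (rule measurable_sets[OF assms(1)])
  moreover have "Y -` (f -` {x} \<inter> space N) \<inter> space M = (\<lambda>s. f (Y s)) -` {x} \<inter> space M"
    using measurable_space[OF assms(1)] by auto
  ultimately show "(\<lambda>s. f (Y s)) -` {x} \<inter> space M \<in> sets M"
    by simp
qed

lemma (in finite_measure) integrable_simple_function:
  fixes f :: "'a \<Rightarrow> real"
  assumes "simple_function M f"
  shows "integrable M f"
proof (rule integrable_const_bound)
  have "finite ((\<lambda>s. norm (f s)) ` space M)"
    using simple_functionD(1)[OF assms] finite_imageI[of "f ` space M" norm]
    by (simp add: image_image)
  then show "AE s in M. norm (f s) \<le> Max ((\<lambda>s. norm (f s)) ` space M)"
    by (intro AE_I2 Max_ge) auto
qed (rule borel_measurable_simple_function[OF assms])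

lemma (in prob_space) indep_rv_compose:
  assumes XY: "indep_rv M N X N' Y" and f: "f \<in> N \<rightarrow>\<^sub>M L" and h: "h \<in> N' \<rightarrow>\<^sub>M L'"
  shows "indep_rv M L (\<lambda>s. f (X s)) L' (\<lambda>s. h (Y s))"
proof -
  have X: "X \<in> M \<rightarrow>\<^sub>M N" and Y: "Y \<in> M \<rightarrow>\<^sub>M N'"
    and ind: "indep_set {X -` A \<inter> space M |A. A \<in> sets N} {Y -` B \<inter> space M |B. B \<in> sets N'}"
    using XY by (auto simp: indep_rv_def)
  have pull: "\<exists>A'. (\<lambda>s. f (Z s)) -` A \<inter> space M = Z -` A' \<inter> space M \<and> A' \<in> sets N"
    if "Z \<in> M \<rightarrow>\<^sub>M N" "f \<in> N \<rightarrow>\<^sub>M L" "A \<in> sets L" for Z and f :: "'z \<Rightarrow> 'y" and N L A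
    using that measurable_space[OF that(1)]
    by (intro exI[of _ "f -` A \<inter> space N"]) (auto intro: measurable_sets)
  have "indep_set {(\<lambda>s. f (X s)) -` A \<inter> space M |A. A \<in> sets L}
      {(\<lambda>s. h (Y s)) -` B \<inter> space M |B. B \<in> sets L'}"
    unfolding indep_set_def
    by (rule indep_sets_mono_sets[OF ind[unfolded indep_set_def]])
       (auto split: bool.split intro: pull[OF X f] pull[OF Y h])
  then show ?thesis
    using measurable_compose[OF X f] measurable_compose[OF Y h] by (simp add: indep_rv_def)
qed

text \<open>
  An element with finitely many values that is independent of \<open>Y\<close> may be averaged out while \<open>Y\<close>
  stays frozen. Splitting according to its value reduces this to the product rule for the
  expectation of independent real random variables.
\<close>

lemma (in prob_space) expectation_freeze:
  fixes \<Psi> :: "'c \<Rightarrow> 'b \<Rightarrow> real"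
  assumes fin: "finite A" and ind: "indep_rv M (count_space A) X N Y"
    and simple: "\<And>w. w \<in> A \<Longrightarrow> simple_function N (\<lambda>y. \<Psi> y w)"
  shows "expectation (\<lambda>s. \<Psi> (Y s) (X s)) =
         expectation (\<lambda>s. \<Sum>w\<in>A. prob {s \<in> space M. X s = w} * \<Psi> (Y s) w)"
proof -
  have X: "X \<in> M \<rightarrow>\<^sub>M count_space A" and Y: "Y \<in> M \<rightarrow>\<^sub>M N"
    using ind by (auto simp: indep_rv_def)
  have XA: "X s \<in> A" if "s \<in> space M" for s
    using measurable_space[OF X that] by simp
  have simpleX: "simple_function M (\<lambda>s. indicator {w} (X s) :: real)" for w
    by (rule simple_function_compose1[OF simple_function_count_space[OF X fin]])
  have simpleY: "simple_function M (\<lambda>s. \<Psi> (Y s) w)" if "w \<in> A" for w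
    by (rule simple_function_measurable_comp[OF Y simple[OF that]])
  have one: "expectation (\<lambda>s. indicator {w} (X s) * \<Psi> (Y s) w)
      = expectation (\<lambda>s. prob {s \<in> space M. X s = w} * \<Psi> (Y s) w)" if "w \<in> A" for w
  proof -
    have "indep_rv M borel (\<lambda>s. indicator {w} (X s) :: real) borel (\<lambda>s. \<Psi> (Y s) w)"
      by (rule indep_rv_compose[OF ind]) (auto intro: borel_measurable_simple_function simple that)
    then have "indep_var borel (\<lambda>s. indicator {w} (X s) :: real) borel (\<lambda>s. \<Psi> (Y s) w)"
      by (simp add: indep_rv_iff_indep_var)
    from indep_var_lebesgue_integral[OF this integrable_simple_function[OF simpleX]
        integrable_simple_function[OF simpleY[OF that]]]
    have "expectation (\<lambda>s. indicator {w} (X s) * \<Psi> (Y s) w)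
        = expectation (\<lambda>s. indicator {w} (X s)) * expectation (\<lambda>s. \<Psi> (Y s) w)" .
    moreover have "expectation (\<lambda>s. indicator {w} (X s) :: real)
        = expectation (indicator {s \<in> space M. X s = w})"
      by (rule Bochner_Integration.integral_cong) (auto simp: indicator_def)
    moreover have "\<dots> = prob {s \<in> space M. X s = w}"
      by (simp add: Int_absorb2 Collect_mono_iff)
    ultimately show ?thesis by simp
  qed
  have "expectation (\<lambda>s. \<Psi> (Y s) (X s)) = expectation (\<lambda>s. \<Sum>w\<in>A. indicator {w} (X s) * \<Psi> (Y s) w)"
  proof (rule Bochner_Integration.integral_cong)
    fix s assume "s \<in> space M"
    from XA[OF this] fin show "\<Psi> (Y s) (X s) = (\<Sum>w\<in>A. indicator {w} (X s) * \<Psi> (Y s) w)"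
      by (simp add: indicator_def)
  qed simp
  also have "\<dots> = (\<Sum>w\<in>A. expectation (\<lambda>s. indicator {w} (X s) * \<Psi> (Y s) w))"
    by (intro Bochner_Integration.integral_sum integrable_simple_function
          simple_function_mult simpleX simpleY)
  also have "\<dots> = (\<Sum>w\<in>A. expectation (\<lambda>s. prob {s \<in> space M. X s = w} * \<Psi> (Y s) w))"
    by (intro sum.cong refl one)
  also have "\<dots> = expectation (\<lambda>s. \<Sum>w\<in>A. prob {s \<in> space M. X s = w} * \<Psi> (Y s) w)"
    by (intro Bochner_Integration.integral_sum[symmetric] integrable_simple_function
          simple_function_mult simple_function_const simpleY)
  finally show ?thesis .
qed

section \<open>Distributed algorithms as random pure strategies\<close>

lemma finite_event_vectors: "finite_alphabets P \<Longrightarrow> finite (event_vectors P)"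
  unfolding event_vectors_def finite_alphabets_def by (intro finite_PiE) auto

lemma finite_pure_strategies: "finite_alphabets P \<Longrightarrow> finite (pure_strategies P)"
  unfolding pure_strategies_def finite_alphabets_def by (intro finite_PiE) auto

text \<open>
  There are only finitely many pure strategies, so it suffices to look at the preimages of single
  ones, and each of these is given by finitely many conditions on single actions.
\<close>

lemma pure_strategy_measurable:
  assumes fin: "finite_alphabets P"
    and f: "\<And>i w. i \<in> {1..n_users P} \<Longrightarrow> w \<in> event_set P i \<Longrightarrow>
      f i w \<in> N \<rightarrow>\<^sub>M count_space (action_set P i)"
  shows "(\<lambda>x. \<lambda>i\<in>{1..n_users P}. \<lambda>w\<in>event_set P i. f i w x) \<in> N \<rightarrow>\<^sub>M count_space (pure_strategies P)"
    (is "?G \<in> _")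
proof -
  have fA: "f i w x \<in> action_set P i"
    if "i \<in> {1..n_users P}" "w \<in> event_set P i" "x \<in> space N" for i w x
    using measurable_space[OF f[OF that(1,2)] that(3)] by simp
  have "?G -` {G} \<inter> space N \<in> sets N" if G: "G \<in> pure_strategies P" for G
  proof -
    have "?G x = G \<longleftrightarrow> (\<forall>i\<in>{1..n_users P}. \<forall>w\<in>event_set P i. f i w x = G i w)" for x
    proof
      assume eq: "\<forall>i\<in>{1..n_users P}. \<forall>w\<in>event_set P i. f i w x = G i w"
      show "?G x = G"
      proof (rule ext)
        fix i
        show "?G x i = G i"
          using eq PiE_mem[OF G[unfolded pure_strategies_def]] PiE_arb[OF G[unfolded pure_strategies_def], of i]
          by (cases "i \<in> {1..n_users P}") (auto simp: PiE_def extensional_def restrict_def fun_eq_iff)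
      qed
    qed auto
    then have "?G -` {G} \<inter> space N =
        {x \<in> space N. \<forall>i\<in>{1..n_users P}. \<forall>w\<in>event_set P i. f i w x = G i w}"
      by auto
    also have "\<dots> \<in> sets N"
    proof (intro sets.sets_Collect_finite_All)
      fix i w assume i: "i \<in> {1..n_users P}" and w: "w \<in> event_set P i"
      then have "f i w -` {G i w} \<inter> space N \<in> sets N"
        using G by (intro measurable_sets[OF f]) (auto simp: pure_strategies_def PiE_iff)
      then show "{x \<in> space N. f i w x = G i w} \<in> sets N"
        by (simp add: vimage_def Int_def conj_commute)
    qed (use fin in \<open>auto simp: finite_alphabets_def\<close>)
    finally show ?thesis .
  qed
  moreover have "?G \<in> space N \<rightarrow> pure_strategies P"
    using fA by (auto simp: pure_strategies_def)
  ultimately show ?thesis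
    using finite_pure_strategies[OF fin] by (simp add: measurable_count_space_eq2)
qed

text \<open>
  Fixing the common information in the decision functions of all users leaves one pure strategy.
  This turns an arbitrary abstract set of common information into a finite one.
\<close>

lemma (in prob_space) distributed_alg_pure_strategies:
  assumes fin: "finite_alphabets P" and dist: "distributed_alg tx M P \<omega> \<alpha>"
  obtains G where
    "\<And>t. indep_rv M (count_space (event_vectors P)) (\<omega> t) (count_space (pure_strategies P)) (G t)"
    "\<And>t s. s \<in> space M \<Longrightarrow> \<alpha> t s = apply_strategy P (G t s) (\<omega> t s)"
proof -
  obtain \<X> and X :: "nat \<Rightarrow> 'a \<Rightarrow> 'd" and f where
    ind: "\<And>t. indep_rv M (count_space (event_vectors P)) (\<omega> t) \<X> (X t)" and
    f: "\<And>i w. i \<in> {1..n_users P} \<Longrightarrow> w \<in> event_set P i \<Longrightarrow>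
      f i w \<in> \<X> \<rightarrow>\<^sub>M count_space (action_set P i)" and
    \<alpha>: "\<And>t s. s \<in> space M \<Longrightarrow> \<alpha> t s = (\<lambda>i\<in>{1..n_users P}. f i (\<omega> t s i) (X t s))"
    using dist unfolding distributed_alg_def by blast
  define G where "G t s = (\<lambda>i\<in>{1..n_users P}. \<lambda>w\<in>event_set P i. f i w (X t s))" for t s
  show thesis
  proof
    show "indep_rv M (count_space (event_vectors P)) (\<omega> t) (count_space (pure_strategies P)) (G t)" for t
      unfolding G_def[abs_def]
      by (rule indep_rv_compose[OF ind _ pure_strategy_measurable[OF fin f], where f="\<lambda>w. w"]) simp
    fix t s assume s: "s \<in> space M"
    have "\<omega> t s \<in> event_vectors P"
      using ind[of t] s by (auto simp: indep_rv_def dest: measurable_space)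
    then show "\<alpha> t s = apply_strategy P (G t s) (\<omega> t s)"
      unfolding \<alpha>[OF s] apply_strategy_def G_def
      by (intro restrict_ext) (auto simp: event_vectors_def PiE_iff)
  qed
qed

locale event_system = prob_space M
  for M :: "'s measure" +
  fixes P :: "('w, 'a) scheduling_problem" and \<omega> :: "nat \<Rightarrow> 's \<Rightarrow> nat \<Rightarrow> 'w"
  assumes finite_alphabets: "finite_alphabets P" and iid_events: "iid_events M P \<omega>"
begin

lemma prob_event: "w \<in> event_vectors P \<Longrightarrow> prob {s \<in> space M. \<omega> t s = w} = event_prob P w"
  using iid_events by (simp add: iid_events_def)

lemma event_measurable: "\<omega> t \<in> M \<rightarrow>\<^sub>M count_space (event_vectors P)"
  using iid_events by (auto simp: iid_events_def indep_vars_def)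

lemma sum_event_prob: "(\<Sum>w\<in>event_vectors P. event_prob P w) = 1"
proof -
  have "(\<Sum>w\<in>event_vectors P. event_prob P w) = (\<Sum>w\<in>event_vectors P. prob {s \<in> space M. \<omega> 0 s = w})"
    by (simp add: prob_event)
  also have "\<dots> = prob (\<Union>w\<in>event_vectors P. {s \<in> space M. \<omega> 0 s = w})"
  proof (rule finite_measure_finite_Union[symmetric])
    show "(\<lambda>w. {s \<in> space M. \<omega> 0 s = w}) ` event_vectors P \<subseteq> events"
    proof (rule image_subsetI)
      fix w assume "w \<in> event_vectors P"
      then have "\<omega> 0 -` {w} \<inter> space M \<in> events"
        by (intro measurable_sets[OF event_measurable]) auto
      then show "{s \<in> space M. \<omega> 0 s = w} \<in> events"
        by (simp add: vimage_def Int_def conj_commute)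
    qed
  qed (auto simp: finite_event_vectors[OF finite_alphabets] disjoint_family_on_def)
  also have "(\<Union>w\<in>event_vectors P. {s \<in> space M. \<omega> 0 s = w}) = space M"
    using measurable_space[OF event_measurable] by auto
  finally show ?thesis by (simp add: prob_space)
qed

text \<open>
  The form in which independence of the current events is used: the sum is the conditional mean
  given the information \<open>Y\<close> on which the decision is based.
\<close>

lemma expectation_freeze_event:
  fixes \<Psi> :: "'c \<Rightarrow> (nat \<Rightarrow> 'w) \<Rightarrow> real"
  assumes "indep_rv M (count_space (event_vectors P)) (\<omega> t) N Y"
    and "\<And>w. w \<in> event_vectors P \<Longrightarrow> simple_function N (\<lambda>y. \<Psi> y w)"
  shows "expectation (\<lambda>s. \<Psi> (Y s) (\<omega> t s)) =
         expectation (\<lambda>s. \<Sum>w\<in>event_vectors P. event_prob P w * \<Psi> (Y s) w)"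
  using expectation_freeze[OF finite_event_vectors[OF finite_alphabets] assms]
  by (simp add: prob_event)

lemma expectation_penalty_pure:
  assumes ind: "indep_rv M (count_space (event_vectors P)) (\<omega> t) (count_space (pure_strategies P)) G"
    and \<alpha>: "\<And>s. s \<in> space M \<Longrightarrow> \<alpha> s = apply_strategy P (G s) (\<omega> t s)"
  shows "expectation (\<lambda>s. penalty P k (\<alpha> s) (\<omega> t s)) = expectation (\<lambda>s. strategy_penalty P k (G s))"
proof -
  have "expectation (\<lambda>s. penalty P k (\<alpha> s) (\<omega> t s))
      = expectation (\<lambda>s. penalty P k (apply_strategy P (G s) (\<omega> t s)) (\<omega> t s))"
    by (rule Bochner_Integration.integral_cong) (auto simp: \<alpha>)
  also have "\<dots> = expectation (\<lambda>s. strategy_penalty P k (G s))"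
    unfolding strategy_penalty_def
    by (rule expectation_freeze_event[OF ind, of "\<lambda>g w. penalty P k (apply_strategy P g w) w"])
       (auto simp: simple_function_def finite_pure_strategies[OF finite_alphabets])
  finally show ?thesis .
qed

lemma expectation_pure_mixture:
  assumes G: "G \<in> M \<rightarrow>\<^sub>M count_space (pure_strategies P)"
    and g: "bij_betw g {1..n :: nat} (pure_strategies P)"
  shows "expectation (\<lambda>s. r (G s)) = (\<Sum>m=1..n. prob {s \<in> space M. G s = g m} * r (g m))"
proof -
  have sets: "{s \<in> space M. G s = g m} \<in> events" if "m \<in> {1..n}" for m
  proof -
    have "G -` {g m} \<inter> space M \<in> events"
      using that g by (intro measurable_sets[OF G]) (auto simp: bij_betw_def)
    then show ?thesis by (simp add: vimage_def Int_def conj_commute)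
  qed
  have "expectation (\<lambda>s. r (G s))
      = expectation (\<lambda>s. \<Sum>m=1..n. indicator {s \<in> space M. G s = g m} s * r (g m))"
  proof (rule Bochner_Integration.integral_cong)
    fix s assume s: "s \<in> space M"
    then have "G s \<in> pure_strategies P"
      using measurable_space[OF G] by simp
    then obtain j where j: "j \<in> {1..n}" "G s = g j"
      using bij_betw_imp_surj_on[OF g] by blast
    have "(\<Sum>m=1..n. indicator {s \<in> space M. G s = g m} s * r (g m))
        = (\<Sum>m=1..n. if m = j then r (g m) else 0)"
      using j s g by (intro sum.cong) (auto simp: indicator_def bij_betw_def inj_on_eq_iff)
    then show "r (G s) = (\<Sum>m=1..n. indicator {s \<in> space M. G s = g m} s * r (g m))"
      using j by simp
  qed simp
  also have "\<dots> = (\<Sum>m=1..n. expectation (\<lambda>s. indicator {s \<in> space M. G s = g m} s * r (g m)))"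
    using sets by (intro Bochner_Integration.integral_sum integrable_mult_left)
      (auto intro!: integrable_real_indicator simp: emeasure_eq_measure)
  also have "\<dots> = (\<Sum>m=1..n. prob {s \<in> space M. G s = g m} * r (g m))"
    using sets by (intro sum.cong) (auto simp: Int_absorb2 Collect_mono_iff)
  finally show ?thesis .
qed

end

section \<open>The linear program bounds the optimal value\<close>

text \<open>
  Bolzano-Weierstrass for finitely many coordinates, refining the subsequence once per coordinate.
\<close>

lemma convergent_subsequence_finite_coordinates:
  fixes x :: "nat \<Rightarrow> 'i \<Rightarrow> real"
  assumes "finite I" and "\<And>n i. i \<in> I \<Longrightarrow> \<bar>x n i\<bar> \<le> b"
  shows "\<exists>r l. strict_mono (r :: nat \<Rightarrow> nat) \<and> (\<forall>i\<in>I. (\<lambda>n. x (r n) i) \<longlonglongrightarrow> l i)"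
  using assms
proof (induction I)
  case empty
  show ?case by (intro exI[of _ "\<lambda>n. n"]) (simp add: strict_mono_def)
next
  case (insert j I)
  then obtain r l where r: "strict_mono (r :: nat \<Rightarrow> nat)" and l: "\<forall>i\<in>I. (\<lambda>n. x (r n) i) \<longlonglongrightarrow> l i"
    by auto
  have "bounded (range (\<lambda>n. x (r n) j))"
    using insert.prems by (intro boundedI[of _ b]) auto
  from bounded_imp_convergent_subsequence[OF this]
  obtain a and r' :: "nat \<Rightarrow> nat" where r': "strict_mono r'" and a: "(\<lambda>n. x (r (r' n)) j) \<longlonglongrightarrow> a"
    by (auto simp: o_def)
  have "(\<lambda>n. x (r (r' n)) i) \<longlonglongrightarrow> (l(j := a)) i" if "i \<in> insert j I" for i
    using that a l LIMSEQ_subseq_LIMSEQ[OF _ r', of "\<lambda>n. x (r n) i" "l i"] insert.hyps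
    by (auto simp: o_def)
  then show ?case
    using strict_mono_o[OF r r'] by (intro exI[of _ "r \<circ> r'"] exI[of _ "l(j := a)"]) (auto simp: o_def)
qed

context event_system
begin

text \<open>
  The weight of a pure strategy is the mean over the slots of the probability that it is used. The
  same weights serve all penalties \<open>k\<close> at once, which is what makes them a candidate solution of
  the linear program. The slot count is \<open>Suc t\<close> because the average over no slots is \<open>0\<close> by
  convention and not a mixture.
\<close>

lemma avg_penalty_mixture:
  assumes g: "bij_betw g {1..n :: nat} (pure_strategies P)" and dist: "distributed_alg tx M P \<omega> \<alpha>"
  obtains \<theta> where
    "\<And>t m. 0 \<le> \<theta> t m" "\<And>t. (\<Sum>m=1..n. \<theta> t m) = 1"
    "\<And>k t. avg_penalty M P \<omega> \<alpha> k (Suc t) = (\<Sum>m=1..n. \<theta> t m * strategy_penalty P k (g m))"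
proof -
  obtain G where
    ind: "\<And>t. indep_rv M (count_space (event_vectors P)) (\<omega> t) (count_space (pure_strategies P)) (G t)" and
    \<alpha>: "\<And>t s. s \<in> space M \<Longrightarrow> \<alpha> t s = apply_strategy P (G t s) (\<omega> t s)"
    using distributed_alg_pure_strategies[OF finite_alphabets dist] by metis
  have G: "G t \<in> M \<rightarrow>\<^sub>M count_space (pure_strategies P)" for t
    using ind[of t] by (simp add: indep_rv_def)
  define q where "q t m = prob {s \<in> space M. G t s = g m}" for t m
  define \<theta> where "\<theta> t m = (1 / real (Suc t)) * (\<Sum>\<tau><Suc t. q \<tau> m)" for t m
  have mix: "expectation (\<lambda>s. r (G \<tau> s)) = (\<Sum>m=1..n. q \<tau> m * r (g m))" for \<tau> r
    unfolding q_def by (rule expectation_pure_mixture[OF G g])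
  have avg: "(\<Sum>m=1..n. \<theta> t m * r (g m)) = (1 / real (Suc t)) * (\<Sum>\<tau><Suc t. expectation (\<lambda>s. r (G \<tau> s)))"
    for t r
  proof -
    have "(\<Sum>m=1..n. \<theta> t m * r (g m)) = (\<Sum>m=1..n. \<Sum>\<tau><Suc t. (1 / real (Suc t)) * (q \<tau> m * r (g m)))"
      by (simp add: \<theta>_def sum_distrib_left sum_distrib_right mult.assoc del: sum.lessThan_Suc)
    also have "\<dots> = (1 / real (Suc t)) * (\<Sum>\<tau><Suc t. \<Sum>m=1..n. q \<tau> m * r (g m))"
      by (subst sum.swap) (simp add: sum_distrib_left del: sum.lessThan_Suc)
    finally show ?thesis unfolding mix .
  qed
  show thesis
  proof
    show "0 \<le> \<theta> t m" for t m
      unfolding \<theta>_def q_def by (intro mult_nonneg_nonneg sum_nonneg) auto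
    show "(\<Sum>m=1..n. \<theta> t m) = 1" for t
      using avg[of t "\<lambda>_. 1"] by (simp add: prob_space del: sum.lessThan_Suc)
    show "avg_penalty M P \<omega> \<alpha> k (Suc t) = (\<Sum>m=1..n. \<theta> t m * strategy_penalty P k (g m))" for k t
      unfolding avg_penalty_def avg by (simp add: expectation_penalty_pure[OF ind \<alpha>] del: sum.lessThan_Suc)
  qed
qed

text \<open>
  A limit point of the weights inherits nonnegativity and total mass, and each of its mean
  penalties is a limit along a subsequence, hence at most the limsup of the whole sequence. For the
  constraints this limsup is at most the target.
\<close>

lemma lp_feasible_le_limsup:
  assumes g: "bij_betw g {1..n} (pure_strategies P)" and dist: "distributed_alg tx M P \<omega> \<alpha>"
    and meets: "meets_constraints M P \<omega> \<alpha>"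
  obtains \<theta> where "\<theta> \<in> lp_feasible P g n"
    "ereal (\<Sum>m=1..n. \<theta> m * strategy_penalty P 0 (g m)) \<le> limsup (\<lambda>t. ereal (avg_penalty M P \<omega> \<alpha> 0 t))"
proof -
  obtain \<theta> where nonneg: "\<And>t m. 0 \<le> \<theta> t m" and sum1: "\<And>t. (\<Sum>m=1..n. \<theta> t m) = 1"
    and avg: "\<And>k t. avg_penalty M P \<omega> \<alpha> k (Suc t) = (\<Sum>m=1..n. \<theta> t m * strategy_penalty P k (g m))"
    using avg_penalty_mixture[OF g dist] by metis
  have "\<bar>\<theta> t m\<bar> \<le> 1" if "m \<in> {1..n}" for t m
    using member_le_sum[of m "{1..n}" "\<theta> t"] that by (simp add: sum1 nonneg del: One_nat_def)
  from convergent_subsequence_finite_coordinates[of "{1..n}" \<theta>, OF _ this]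
  obtain r l where r: "strict_mono r" and l: "\<forall>m\<in>{1..n}. (\<lambda>t. \<theta> (r t) m) \<longlonglongrightarrow> l m"
    by auto
  have below: "ereal (\<Sum>m=1..n. l m * strategy_penalty P k (g m)) \<le> limsup (\<lambda>t. ereal (avg_penalty M P \<omega> \<alpha> k t))"
    for k
  proof -
    have "(\<lambda>t. avg_penalty M P \<omega> \<alpha> k (Suc (r t))) \<longlonglongrightarrow> (\<Sum>m=1..n. l m * strategy_penalty P k (g m))"
      unfolding avg using l by (intro tendsto_sum tendsto_mult tendsto_const) auto
    then have "(\<lambda>t. ereal (avg_penalty M P \<omega> \<alpha> k (Suc (r t)))) \<longlonglongrightarrow>
        ereal (\<Sum>m=1..n. l m * strategy_penalty P k (g m))"
      by (intro tendsto_intros)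
    then have "limsup (\<lambda>t. ereal (avg_penalty M P \<omega> \<alpha> k (Suc (r t)))) =
        ereal (\<Sum>m=1..n. l m * strategy_penalty P k (g m))"
      by (intro lim_imp_Limsup) simp_all
    moreover have "strict_mono (\<lambda>t. Suc (r t))"
      using r by (simp add: strict_mono_def)
    note limsup_subseq_mono[OF this, of "\<lambda>t. ereal (avg_penalty M P \<omega> \<alpha> k t)"]
    ultimately show ?thesis by (simp add: o_def)
  qed
  show thesis
  proof
    have "0 \<le> l m" if "m \<in> {1..n}" for m
      using l that nonneg by (intro LIMSEQ_le_const[of "\<lambda>t. \<theta> (r t) m"]) auto
    moreover have "(\<lambda>t. \<Sum>m=1..n. \<theta> (r t) m) \<longlonglongrightarrow> (\<Sum>m=1..n. l m)"
      using l by (intro tendsto_sum) auto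
    then have "(\<Sum>m=1..n. l m) = 1"
      by (simp add: sum1 LIMSEQ_const_iff del: One_nat_def)
    moreover have "(\<Sum>m=1..n. l m * strategy_penalty P k (g m)) \<le> target P k"
      if "k \<in> {1..n_constraints P}" for k
    proof -
      have "limsup (\<lambda>t. ereal (avg_penalty M P \<omega> \<alpha> k t)) \<le> ereal (target P k)"
        using meets that by (simp add: meets_constraints_def)
      from order_trans[OF below this] show ?thesis
        by simp
    qed
    ultimately show "l \<in> lp_feasible P g n"
      by (simp add: lp_feasible_def)
  qed (rule below)
qed

lemma lp_value_le_p0_opt:
  assumes g: "bij_betw g {1..n} (pure_strategies P)"
  shows "lp_value P g n \<le> p0_opt tx M P \<omega>"
  unfolding p0_opt_def
proof (intro INF_greatest, clarify)
  fix \<alpha> assume "distributed_alg tx M P \<omega> \<alpha>" "meets_constraints M P \<omega> \<alpha>"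
  from lp_feasible_le_limsup[OF g this] obtain \<theta> where "\<theta> \<in> lp_feasible P g n"
    and le: "ereal (\<Sum>m=1..n. \<theta> m * strategy_penalty P 0 (g m)) \<le> limsup (\<lambda>t. ereal (avg_penalty M P \<omega> \<alpha> 0 t))" .
  from INF_lower[OF this(1), of "\<lambda>\<theta>. ereal (\<Sum>m=1..n. \<theta> m * strategy_penalty P 0 (g m))"] le
  show "lp_value P g n \<le> limsup (\<lambda>t. ereal (avg_penalty M P \<omega> \<alpha> 0 t))"
    unfolding lp_value_def by (rule order_trans)
qed

text \<open>
  The program restricted to the first \<open>Mt\<close> strategies has the same value as the full one, so it
  cannot have the value \<open>\<infinity>\<close> of an infeasible program.
\<close>

lemma lp_feasible_nonempty:
  assumes g: "strategy_enumeration P g Mt" and feas: "feasible_problem tx M P \<omega>"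
  shows "lp_feasible P g Mt \<noteq> {}"
proof
  assume empty: "lp_feasible P g Mt = {}"
  have bij: "bij_betw g {1..n_strategies P} (pure_strategies P)"
    and val: "lp_value P g Mt = lp_value P g (n_strategies P)"
    using g by (auto simp: strategy_enumeration_def)
  from feas obtain \<alpha> where "distributed_alg tx M P \<omega> \<alpha>" "meets_constraints M P \<omega> \<alpha>"
    by (auto simp: feasible_problem_def)
  from lp_feasible_le_limsup[OF bij this]
  obtain \<theta> where "\<theta> \<in> lp_feasible P g (n_strategies P)" by metis
  from INF_lower[OF this, of "\<lambda>\<theta>. ereal (\<Sum>m=1..n_strategies P. \<theta> m * strategy_penalty P 0 (g m))"]
  have "lp_value P g (n_strategies P) < \<infinity>"
    unfolding lp_value_def by (rule le_less_trans) simp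
  moreover have "lp_value P g Mt = \<infinity>"
    by (simp add: lp_value_def empty top_ereal_def)
  ultimately show False
    using val by simp
qed

end

section \<open>Queues with delayed feedback\<close>

lemma queue_rec_nonneg: "0 \<le> q \<Longrightarrow> 0 \<le> queue_rec D c q p t"
  by (cases t) auto

lemma queue_rec_cong: "(\<And>\<tau>. \<tau> < t \<Longrightarrow> p \<tau> = p' \<tau>) \<Longrightarrow> queue_rec D c q p t = queue_rec D c q p' t"
  by (induction t) auto

text \<open>
  A queue dominates the accumulated excess of the penalties over the target. The penalties of the
  slots below \<open>t\<close> have arrived at time \<open>D + t\<close>.
\<close>

lemma queue_rec_ge_sum:
  "queue_rec D c q p D + (\<Sum>\<tau><t. p \<tau> - c) \<le> queue_rec D c q p (D + t)"
  by (induction t) (auto simp: max_def)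

text \<open>
  The queues along one fixed sequence of penalties. The drift estimate is a statement about each
  outcome separately; expectations are taken only afterwards.
\<close>

locale queue_vector =
  fixes K :: "nat set" and D :: nat and c q :: "nat \<Rightarrow> real" and p :: "nat \<Rightarrow> nat \<Rightarrow> real"
  assumes initial_nonneg: "k \<in> K \<Longrightarrow> 0 \<le> q k"
begin

definition Q :: "nat \<Rightarrow> nat \<Rightarrow> real" where
  "Q t k = queue_rec D (c k) (q k) (p k) t"

definition deviation :: "nat \<Rightarrow> real" where
  "deviation t = L2_set (\<lambda>k. p k t - c k) K"

lemma Q_nonneg: "k \<in> K \<Longrightarrow> 0 \<le> Q t k"
  unfolding Q_def by (intro queue_rec_nonneg initial_nonneg)

lemma Q_Suc: "Q (Suc (D + t)) k = max (Q (D + t) k + (p k t - c k)) 0"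
  by (simp add: Q_def algebra_simps)

text \<open>
  Truncation at \<open>0\<close> does not enlarge the step of a nonnegative queue.
\<close>

lemma queue_step_le_deviation: "L2_set (\<lambda>k. Q (Suc (D + t)) k - Q (D + t) k) K \<le> deviation t"
proof -
  have "L2_set (\<lambda>k. Q (Suc (D + t)) k - Q (D + t) k) K
      \<le> L2_set (\<lambda>k. \<bar>Q (Suc (D + t)) k - Q (D + t) k\<bar>) K"
    by (simp add: L2_set_def)
  also have "\<dots> \<le> L2_set (\<lambda>k. \<bar>p k t - c k\<bar>) K"
  proof (rule L2_set_mono)
    fix k assume "k \<in> K"
    from Q_nonneg[OF this, of "D + t"] show "\<bar>Q (Suc (D + t)) k - Q (D + t) k\<bar> \<le> \<bar>p k t - c k\<bar>"
      unfolding Q_Suc by linarith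
  qed simp
  also have "\<dots> = deviation t"
    by (simp add: L2_set_def deviation_def)
  finally show ?thesis .
qed

lemma queue_displacement_genuine:
  assumes "a \<le> b"
  shows "L2_set (\<lambda>k. Q (D + b) k - Q (D + a) k) K \<le> (\<Sum>\<tau>\<in>{a..<b}. deviation \<tau>)"
  using assms
proof (induction b rule: dec_induct)
  case base
  show ?case by (simp add: L2_set_def)
next
  case (step b)
  have "L2_set (\<lambda>k. Q (D + Suc b) k - Q (D + a) k) K
      = L2_set (\<lambda>k. (Q (D + b) k - Q (D + a) k) + (Q (Suc (D + b)) k - Q (D + b) k)) K"
    by simp
  also have "\<dots> \<le> L2_set (\<lambda>k. Q (D + b) k - Q (D + a) k) K
      + L2_set (\<lambda>k. Q (Suc (D + b)) k - Q (D + b) k) K"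
    by (rule L2_set_triangle_ineq)
  also have "\<dots> \<le> (\<Sum>\<tau>\<in>{a..<b}. deviation \<tau>) + deviation b"
    by (intro add_mono step.IH queue_step_le_deviation)
  finally show ?case
    using step.hyps by simp
qed

text \<open>
  Queue steps in slots below \<open>D\<close> are not caused by actual penalties, so only those in later slots
  are bounded by deviations. If \<open>t < D\<close>, the path from \<open>t\<close> to \<open>D + t\<close> is cut at \<open>D\<close>; otherwise
  the first term is \<open>0\<close>. In both cases the actual steps are those due to the penalties of the slots
  \<open>t - D\<close> to \<open>t - 1\<close>, with truncated subtraction.
\<close>

lemma queue_displacement:
  "L2_set (\<lambda>k. Q (D + t) k - Q t k) K
    \<le> L2_set (\<lambda>k. Q D k - Q (min t D) k) K + (\<Sum>\<tau>\<in>{t - D..<t}. deviation \<tau>)"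
proof (cases "D \<le> t")
  case True
  then show ?thesis
    using queue_displacement_genuine[of "t - D" t] by (simp add: L2_set_def)
next
  case False
  have "L2_set (\<lambda>k. Q (D + t) k - Q t k) K
      = L2_set (\<lambda>k. (Q D k - Q t k) + (Q (D + t) k - Q (D + 0) k)) K"
    by simp
  also have "\<dots> \<le> L2_set (\<lambda>k. Q D k - Q t k) K + L2_set (\<lambda>k. Q (D + t) k - Q (D + 0) k) K"
    by (rule L2_set_triangle_ineq)
  also have "\<dots> \<le> L2_set (\<lambda>k. Q D k - Q t k) K + (\<Sum>\<tau>\<in>{0..<t}. deviation \<tau>)"
    by (intro add_left_mono queue_displacement_genuine) simp
  finally show ?thesis
    using False by (simp add: min_def)
qed

text \<open>
  Squaring the queue recursion gives the usual drift estimate with the inner product of \<open>Q (D + t)\<close>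
  and the deviation. Only the product with \<open>Q t\<close> is controlled by the choice made in slot \<open>t\<close>; the
  Cauchy-Schwarz inequality bounds the difference.
\<close>

lemma delayed_drift:
  "(1/2) * (\<Sum>k\<in>K. (Q (D + Suc t) k)\<^sup>2) - (1/2) * (\<Sum>k\<in>K. (Q (D + t) k)\<^sup>2)
    \<le> (1/2) * (deviation t)\<^sup>2 + (\<Sum>k\<in>K. Q t k * (p k t - c k))
      + (L2_set (\<lambda>k. Q D k - Q (min t D) k) K + (\<Sum>\<tau>\<in>{t - D..<t}. deviation \<tau>)) * deviation t"
proof -
  have sq: "(deviation t)\<^sup>2 = (\<Sum>k\<in>K. (p k t - c k)\<^sup>2)"
    by (simp add: deviation_def L2_set_def sum_nonneg)
  have "(\<Sum>k\<in>K. (Q (D + Suc t) k)\<^sup>2)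
      \<le> (\<Sum>k\<in>K. (Q (D + t) k)\<^sup>2 + (p k t - c k)\<^sup>2 + 2 * (Q t k * (p k t - c k))
            + 2 * ((Q (D + t) k - Q t k) * (p k t - c k)))"
  proof (rule sum_mono)
    fix k
    have "(Q (D + Suc t) k)\<^sup>2 \<le> (Q (D + t) k + (p k t - c k))\<^sup>2"
      by (simp add: Q_Suc max_def)
    also have "\<dots> = (Q (D + t) k)\<^sup>2 + (p k t - c k)\<^sup>2 + 2 * (Q t k * (p k t - c k))
            + 2 * ((Q (D + t) k - Q t k) * (p k t - c k))"
      by (simp add: power2_eq_square algebra_simps)
    finally show "(Q (D + Suc t) k)\<^sup>2 \<le> \<dots>" .
  qed
  also have "\<dots> = (\<Sum>k\<in>K. (Q (D + t) k)\<^sup>2) + (deviation t)\<^sup>2 + 2 * (\<Sum>k\<in>K. Q t k * (p k t - c k))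
      + 2 * (\<Sum>k\<in>K. (Q (D + t) k - Q t k) * (p k t - c k))"
    by (simp add: sum.distrib sum_distrib_left sq)
  finally have drift: "(\<Sum>k\<in>K. (Q (D + Suc t) k)\<^sup>2) \<le> \<dots>" .
  have "(\<Sum>k\<in>K. (Q (D + t) k - Q t k) * (p k t - c k))
      \<le> (\<Sum>k\<in>K. \<bar>Q (D + t) k - Q t k\<bar> * \<bar>p k t - c k\<bar>)"
    by (intro sum_mono) (simp add: abs_mult[symmetric])
  also have "\<dots> \<le> L2_set (\<lambda>k. Q (D + t) k - Q t k) K * deviation t"
    unfolding deviation_def by (rule L2_set_mult_ineq)
  also have "\<dots> \<le> (L2_set (\<lambda>k. Q D k - Q (min t D) k) K + (\<Sum>\<tau>\<in>{t - D..<t}. deviation \<tau>)) * deviation t"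
    by (intro mult_right_mono queue_displacement) (simp add: deviation_def)
  finally show ?thesis
    using drift by linarith
qed

end

text \<open>
  The bookkeeping of the error terms caused by the delay, where \<open>b\<close> is \<open>sqrt (2 B)\<close> and \<open>d\<close> the
  deterministic displacement up to time \<open>D\<close>. In a slot \<open>\<tau> < D\<close> the displacement consists of
  \<open>\<tau>\<close> actual steps, allowed \<open>b\<close> each, and of \<open>D - \<tau>\<close> steps without penalties. Granting \<open>b\<close> to
  each of the latter too makes \<open>D b\<^sup>2\<close> in every slot, and what exceeds the grant is the startup
  excess. It occurs only in the first \<open>D\<close> slots, hence does not grow with \<open>t\<close>.
\<close>

lemma sum_startup_excess_le:
  fixes d :: "nat \<Rightarrow> real" and b :: real
  assumes "0 \<le> b" and "\<And>j. D \<le> j \<Longrightarrow> d j = 0"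
  shows "(\<Sum>\<tau><t. b * (d \<tau> + real (min \<tau> D) * b))
    \<le> real t * (real D * b\<^sup>2) + b * (\<Sum>j<D. max 0 (d j - real (D - j) * b))"
proof -
  let ?e = "\<lambda>\<tau>. if \<tau> < D then max 0 (d \<tau> - real (D - \<tau>) * b) else 0"
  have "b * (d \<tau> + real (min \<tau> D) * b) \<le> real D * b\<^sup>2 + b * ?e \<tau>" for \<tau>
  proof -
    have "d \<tau> + real (min \<tau> D) * b \<le> real D * b + ?e \<tau>"
      using assms by (cases "\<tau> < D") (auto simp: min_def of_nat_diff algebra_simps)
    from mult_left_mono[OF this assms(1)] show ?thesis
      by (simp add: power2_eq_square algebra_simps)
  qed
  then have "(\<Sum>\<tau><t. b * (d \<tau> + real (min \<tau> D) * b)) \<le> (\<Sum>\<tau><t. real D * b\<^sup>2 + b * ?e \<tau>)"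
    by (rule sum_mono)
  also have "\<dots> = real t * (real D * b\<^sup>2) + b * (\<Sum>\<tau><t. ?e \<tau>)"
    by (simp add: sum.distrib sum_distrib_left)
  also have "(\<Sum>\<tau><t. ?e \<tau>) = (\<Sum>\<tau>\<in>{..<t} \<inter> {..<D}. max 0 (d \<tau> - real (D - \<tau>) * b))"
    by (simp add: sum.If_cases lessThan_def)
  also have "\<dots> \<le> (\<Sum>j<D. max 0 (d j - real (D - j) * b))"
    by (rule sum_mono2) auto
  finally show ?thesis
    using assms(1) by (simp add: mult_left_mono)
qed

section \<open>Runs and their histories\<close>

lemma simple_function_queue_rec:
  assumes "\<And>\<tau>. \<tau> < t \<Longrightarrow> simple_function N (p \<tau>)"
  shows "simple_function N (\<lambda>x. queue_rec D c q (\<lambda>\<tau>. p \<tau> x) t)"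
  using assms
proof (induction t)
  case (Suc t)
  have Q: "simple_function N (\<lambda>x. queue_rec D c q (\<lambda>\<tau>. p \<tau> x) t)"
    using Suc by simp
  have p: "simple_function N (\<lambda>x. if D \<le> t then p (t - D) x else 0)"
    using Suc.prems[of "t - D"] by (cases "D \<le> t") simp_all
  show ?case
    using simple_function_compose2[OF Q p, of "\<lambda>a b. max (a + b - c) 0"] by simp
qed simp

text \<open>
  The variance is nonnegative.
\<close>

lemma (in prob_space) expectation_le_of_square:
  fixes f :: "'a \<Rightarrow> real"
  assumes f: "simple_function M f" and sq: "expectation (\<lambda>s. (f s)\<^sup>2) \<le> b\<^sup>2" and b: "0 \<le> b"
  shows "expectation f \<le> b"
proof -
  have "(expectation f)\<^sup>2 \<le> expectation (\<lambda>s. (f s)\<^sup>2)"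
    using variance_positive[of f] variance_eq[OF integrable_simple_function[OF f]
        integrable_simple_function[OF simple_function_compose1[OF f, of "\<lambda>x. x\<^sup>2"]]] by simp
  then show ?thesis
    using sq b by (meson order_trans power2_le_imp_le)
qed

text \<open>
  A run of the algorithm together with the sequence \<open>m\<close> of strategy indices that generates it.
\<close>

locale drift_plus_penalty_run = event_system M P \<omega>
  for M :: "'s measure" and P :: "('w, 'a) scheduling_problem" and \<omega> +
  fixes g :: "nat \<Rightarrow> nat \<Rightarrow> 'w \<Rightarrow> 'a" and Mt D :: nat and Q0 :: "nat \<Rightarrow> real" and V :: real
    and \<alpha> :: "nat \<Rightarrow> 's \<Rightarrow> nat \<Rightarrow> 'a" and m :: "nat \<Rightarrow> 's \<Rightarrow> nat"
  assumes initial_queue_nonneg: "k \<in> {1..n_constraints P} \<Longrightarrow> 0 \<le> Q0 k"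
    and V_nonneg: "0 \<le> V"
    and choice_minimizes: "s \<in> space M \<Longrightarrow>
      is_arg_min
        (\<lambda>j. V * strategy_penalty P 0 (g j) +
             (\<Sum>k=1..n_constraints P. virtual_queue P D Q0 \<omega> \<alpha> k t s * strategy_penalty P k (g j)))
        (\<lambda>j. j \<in> {1..Mt}) (m t s)"
    and action: "s \<in> space M \<Longrightarrow> \<alpha> t s = apply_strategy P (g (m t s)) (\<omega> t s)"
    and event_fresh: "indep_rv M (count_space (event_vectors P)) (\<omega> t)
           (PiM {..<t} (\<lambda>_. count_space (event_vectors P)) \<Otimes>\<^sub>M
            PiM {..t} (\<lambda>_. count_space {1..Mt}))
           (\<lambda>s. (\<lambda>\<tau>\<in>{..<t}. \<omega> \<tau> s, \<lambda>\<tau>\<in>{..t}. m \<tau> s))"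
begin

\<comment> \<open>Index sets keep the form \<open>{1..n}\<close> in which they occur in the definitions.\<close>
declare One_nat_def [simp del]

sublocale queues: queue_vector "{1..n_constraints P}" D "target P" Q0
    "\<lambda>k \<tau>. penalty P k (\<alpha> \<tau> s) (\<omega> \<tau> s)" for s
  by unfold_locales (rule initial_queue_nonneg)

abbreviation "K \<equiv> {1..n_constraints P}"
abbreviation "pen k t s \<equiv> penalty P k (\<alpha> t s) (\<omega> t s)"
abbreviation "Q \<equiv> queues.Q"
definition dev :: "nat \<Rightarrow> 's \<Rightarrow> real" where "dev t s = queues.deviation s t"
abbreviation "history_space t \<equiv> PiM {..<t} (\<lambda>_. count_space (event_vectors P)) \<Otimes>\<^sub>M
            PiM {..t} (\<lambda>_. count_space {1..Mt})"
abbreviation "history t s \<equiv> (\<lambda>\<tau>\<in>{..<t}. \<omega> \<tau> s, \<lambda>\<tau>\<in>{..t}. m \<tau> s)"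

lemma virtual_queue_eq: "virtual_queue P D Q0 \<omega> \<alpha> k t s = Q s t k"
  by (simp add: virtual_queue_def queues.Q_def)

lemma history_measurable: "history t \<in> M \<rightarrow>\<^sub>M history_space t"
  using event_fresh[of t] by (simp add: indep_rv_def)

lemma past_event_measurable:
  "\<tau> < t \<Longrightarrow> (\<lambda>h. fst h \<tau>) \<in> history_space t \<rightarrow>\<^sub>M count_space (event_vectors P)"
  by (rule measurable_compose[OF measurable_fst]) (rule measurable_component_singleton, simp)

lemma past_choice_measurable:
  "\<tau> \<le> t \<Longrightarrow> (\<lambda>h. snd h \<tau>) \<in> history_space t \<rightarrow>\<^sub>M count_space {1..Mt}"
  by (rule measurable_compose[OF measurable_snd]) (rule measurable_component_singleton, simp)

lemma choice_measurable: "m t \<in> M \<rightarrow>\<^sub>M count_space {1..Mt}"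
  using measurable_compose[OF history_measurable past_choice_measurable[OF order_refl], of t]
  by simp

lemma choice_range: "s \<in> space M \<Longrightarrow> m t s \<in> {1..Mt}"
  using measurable_space[OF choice_measurable] by simp

lemmas simple_event = simple_function_count_space[OF event_measurable finite_event_vectors[OF finite_alphabets]]
lemmas simple_choice = simple_function_count_space[OF choice_measurable finite_atLeastAtMost]
lemmas simple_past_event =
  simple_function_count_space[OF past_event_measurable finite_event_vectors[OF finite_alphabets]]
lemmas simple_past_choice = simple_function_count_space[OF past_choice_measurable finite_atLeastAtMost]

lemma simple_pen: "simple_function M (pen k t)"
proof -
  have "simple_function M (\<lambda>s. penalty P k (apply_strategy P (g (m t s)) (\<omega> t s)) (\<omega> t s))"
    by (rule simple_function_compose2[OF simple_choice simple_event])
  then show ?thesis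
    using simple_function_cong[of M "pen k t"] action by simp
qed

lemma simple_queue: "simple_function M (\<lambda>s. Q s t k)"
  unfolding queues.Q_def by (intro simple_function_queue_rec simple_pen)

lemma simple_dev: "simple_function M (dev t)"
  unfolding dev_def[abs_def] queues.deviation_def L2_set_def
  by (intro simple_function_compose1[of M _ sqrt] simple_function_sum
        simple_function_compose1[OF simple_pen, of "\<lambda>x. (x - _)\<^sup>2"])

lemma simple_lyapunov: "simple_function M (lyapunov P D Q0 \<omega> \<alpha> t)"
  unfolding lyapunov_def[abs_def] virtual_queue_eq
  by (intro simple_function_mult simple_function_const simple_function_sum
        simple_function_compose1[OF simple_queue, of "\<lambda>x. x\<^sup>2"])

lemmas simple_integrable = integrable_simple_function

text \<open>
  The queues as functions of the history space. Independence is stated for the history as a random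
  element, so a quantity may be frozen only if it is exhibited as a function of it.
\<close>

definition past_queue :: "nat \<Rightarrow> nat \<Rightarrow> (nat \<Rightarrow> nat \<Rightarrow> 'w) \<times> (nat \<Rightarrow> nat) \<Rightarrow> real" where
  "past_queue t k h = queue_rec D (target P k) (Q0 k)
     (\<lambda>\<tau>. penalty P k (apply_strategy P (g (snd h \<tau>)) (fst h \<tau>)) (fst h \<tau>)) t"

lemma past_queue_history: "s \<in> space M \<Longrightarrow> past_queue t k (history t s) = Q s t k"
  unfolding past_queue_def queues.Q_def by (rule queue_rec_cong) (simp add: action)

lemma simple_past_queue: "simple_function (history_space t) (past_queue t k)"
  unfolding past_queue_def[abs_def]
proof (intro simple_function_queue_rec)
  fix \<tau> assume "\<tau> < t"
  then show "simple_function (history_space t)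
      (\<lambda>h. penalty P k (apply_strategy P (g (snd h \<tau>)) (fst h \<tau>)) (fst h \<tau>))"
    by (intro simple_function_compose2[OF simple_past_choice simple_past_event]) auto
qed

text \<open>
  The queues at time \<open>t\<close> depend on earlier slots only and the index \<open>m t\<close> belongs to the history,
  so both may be kept fixed while the events of slot \<open>t\<close> are averaged out.
\<close>

lemma expectation_freeze_history:
  fixes \<Psi> :: "(nat \<Rightarrow> real) \<Rightarrow> nat \<Rightarrow> (nat \<Rightarrow> 'w) \<Rightarrow> real"
  assumes "\<And>w. simple_function (history_space t) (\<lambda>h. \<Psi> (\<lambda>k. past_queue t k h) (snd h t) w)"
  shows "expectation (\<lambda>s. \<Psi> (Q s t) (m t s) (\<omega> t s)) =
    expectation (\<lambda>s. \<Sum>w\<in>event_vectors P. event_prob P w * \<Psi> (Q s t) (m t s) w)"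
proof -
  have Q: "(\<lambda>k. past_queue t k (history t s)) = Q s t" if "s \<in> space M" for s
    using past_queue_history[OF that] by (rule ext)
  have "expectation (\<lambda>s. \<Psi> (Q s t) (m t s) (\<omega> t s))
      = expectation (\<lambda>s. \<Psi> (\<lambda>k. past_queue t k (history t s)) (snd (history t s) t) (\<omega> t s))"
    by (rule Bochner_Integration.integral_cong) (simp_all only: Q, simp)
  also have "\<dots> = expectation (\<lambda>s. \<Sum>w\<in>event_vectors P. event_prob P w *
      \<Psi> (\<lambda>k. past_queue t k (history t s)) (snd (history t s) t) w)"
    by (rule expectation_freeze_event[OF event_fresh,
          where \<Psi> = "\<lambda>h w. \<Psi> (\<lambda>k. past_queue t k h) (snd h t) w"]) (rule assms)
  also have "\<dots> = expectation (\<lambda>s. \<Sum>w\<in>event_vectors P. event_prob P w * \<Psi> (Q s t) (m t s) w)"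
    by (rule Bochner_Integration.integral_cong) (simp_all only: Q, simp)
  finally show ?thesis .
qed

lemma expectation_pen: "expectation (pen k t) = expectation (\<lambda>s. strategy_penalty P k (g (m t s)))"
proof -
  have "expectation (pen k t)
      = expectation (\<lambda>s. penalty P k (apply_strategy P (g (m t s)) (\<omega> t s)) (\<omega> t s))"
    by (rule Bochner_Integration.integral_cong) (auto simp: action)
  also have "\<dots> = expectation (\<lambda>s. strategy_penalty P k (g (m t s)))"
    unfolding strategy_penalty_def
    by (rule expectation_freeze_history[of t "\<lambda>q j w. penalty P k (apply_strategy P (g j) w) w"])
       (intro simple_function_compose1[OF simple_past_choice] order_refl)
  finally show ?thesis .
qed

section \<open>Expected drift plus penalty\<close>

abbreviation "B \<equiv> drift_const P g Mt"

lemma strategy_deviation_le_B: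
  assumes "j \<in> {1..Mt}"
  shows "(\<Sum>w\<in>event_vectors P. event_prob P w *
      (\<Sum>k\<in>K. (penalty P k (apply_strategy P (g j) w) w - target P k)\<^sup>2)) \<le> 2 * B"
proof -
  let ?b = "\<lambda>j. (1/2) * (\<Sum>k=1..n_constraints P. \<Sum>w\<in>event_vectors P.
        event_prob P w * \<bar>penalty P k (apply_strategy P (g j) w) w - target P k\<bar>\<^sup>2)"
  have "?b j \<le> B"
    unfolding drift_const_def using assms by (intro Max_ge) auto
  moreover have "(\<Sum>w\<in>event_vectors P. event_prob P w *
      (\<Sum>k\<in>K. (penalty P k (apply_strategy P (g j) w) w - target P k)\<^sup>2)) = 2 * ?b j"
    by (simp add: sum_distrib_left sum.swap[of _ "event_vectors P"])
  ultimately show ?thesis by simp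
qed

lemma dev_square: "(dev t s)\<^sup>2 = (\<Sum>k\<in>K. (pen k t s - target P k)\<^sup>2)"
  by (simp add: dev_def queues.deviation_def L2_set_def sum_nonneg)

text \<open>
  Given the chosen index, the mean squared deviation is twice one of the terms whose maximum is
  \<open>B\<close>.
\<close>

lemma expectation_dev_square: "expectation (\<lambda>s. (dev t s)\<^sup>2) \<le> 2 * B"
proof -
  have "expectation (\<lambda>s. (dev t s)\<^sup>2)
      = expectation (\<lambda>s. \<Sum>k\<in>K. (penalty P k (apply_strategy P (g (m t s)) (\<omega> t s)) (\<omega> t s) - target P k)\<^sup>2)"
    by (rule Bochner_Integration.integral_cong)
       (auto simp: dev_square action)
  also have "\<dots> = expectation (\<lambda>s. \<Sum>w\<in>event_vectors P. event_prob P w *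
      (\<Sum>k\<in>K. (penalty P k (apply_strategy P (g (m t s)) w) w - target P k)\<^sup>2))"
    by (rule expectation_freeze_history[of t
          "\<lambda>q j w. \<Sum>k\<in>K. (penalty P k (apply_strategy P (g j) w) w - target P k)\<^sup>2"])
       (intro simple_function_compose1[OF simple_past_choice] order_refl)
  also have "\<dots> \<le> expectation (\<lambda>s. 2 * B)"
    by (intro integral_mono simple_integrable simple_function_const
          simple_function_compose1[OF simple_choice] strategy_deviation_le_B choice_range)
  finally show ?thesis by (simp add: prob_space)
qed

lemma B_nonneg: "0 \<le> B"
proof -
  have "0 \<le> expectation (\<lambda>s. (dev 0 s)\<^sup>2)"
    by (intro integral_nonneg_AE) simp
  then show ?thesis
    using expectation_dev_square[of 0] by linarith
qed

lemma expectation_dev: "expectation (dev t) \<le> sqrt (2 * B)"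
proof (rule expectation_le_of_square[OF simple_dev])
  show "expectation (\<lambda>s. (dev t s)\<^sup>2) \<le> (sqrt (2 * B))\<^sup>2"
    using expectation_dev_square B_nonneg by simp
qed (use B_nonneg in simp)

lemma expectation_dev_product: "expectation (\<lambda>s. dev \<tau> s * dev t s) \<le> 2 * B"
proof -
  have "expectation (\<lambda>s. dev \<tau> s * dev t s) \<le> expectation (\<lambda>s. (1/2) * ((dev \<tau> s)\<^sup>2 + (dev t s)\<^sup>2))"
  proof (intro integral_mono simple_integrable)
    fix s
    show "dev \<tau> s * dev t s \<le> (1/2) * ((dev \<tau> s)\<^sup>2 + (dev t s)\<^sup>2)"
      using sum_squares_bound[of "dev \<tau> s" "dev t s"] by simp
  next
    show "simple_function M (\<lambda>s. dev \<tau> s * dev t s)"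
      by (intro simple_function_mult simple_dev)
    show "simple_function M (\<lambda>s. (1/2) * ((dev \<tau> s)\<^sup>2 + (dev t s)\<^sup>2))"
      by (rule simple_function_compose2[OF simple_dev simple_dev])
  qed
  also have "\<dots> = (1/2) * (expectation (\<lambda>s. (dev \<tau> s)\<^sup>2) + expectation (\<lambda>s. (dev t s)\<^sup>2))"
    by (simp add: simple_integrable simple_function_compose1[OF simple_dev, of "\<lambda>x. x\<^sup>2"])
  also have "\<dots> \<le> 2 * B"
    using expectation_dev_square[of \<tau>] expectation_dev_square[of t] by simp
  finally show ?thesis .
qed

text \<open>
  Given the history, the mean of this sum is the minimized expression at \<open>m t\<close> minus the
  inner product of queues and targets. The minimum is at most the mean with weights \<open>\<theta>\<close>, and
  there the nonnegative queues are multiplied by mixed penalties which do not exceed the targets,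
  so that the inner product cancels.
\<close>

lemma drift_plus_penalty_le_mixture:
  assumes \<theta>: "\<theta> \<in> lp_feasible P g Mt"
  shows "V * expectation (pen 0 t) + expectation (\<lambda>s. \<Sum>k\<in>K. Q s t k * (pen k t s - target P k))
    \<le> V * (\<Sum>j=1..Mt. \<theta> j * strategy_penalty P 0 (g j))"
proof -
  define r where "r k j = strategy_penalty P k (g j)" for k j
  define \<Psi> where "\<Psi> q j w = V * penalty P 0 (apply_strategy P (g j) w) w
      + (\<Sum>k\<in>K. q k * (penalty P k (apply_strategy P (g j) w) w - target P k))" for q j w
  have simple_term: "simple_function M (\<lambda>s. Q s t k * (pen k t s - target P k))" for k
    by (rule simple_function_compose2[OF simple_queue simple_pen])
  have "V * expectation (pen 0 t) + expectation (\<lambda>s. \<Sum>k\<in>K. Q s t k * (pen k t s - target P k))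
      = expectation (\<lambda>s. V * pen 0 t s + (\<Sum>k\<in>K. Q s t k * (pen k t s - target P k)))"
    by (simp add: simple_integrable simple_pen simple_term)
  also have "\<dots> = expectation (\<lambda>s. \<Psi> (Q s t) (m t s) (\<omega> t s))"
    by (rule Bochner_Integration.integral_cong) (auto simp: \<Psi>_def action)
  also have "\<dots> = expectation (\<lambda>s. \<Sum>w\<in>event_vectors P. event_prob P w * \<Psi> (Q s t) (m t s) w)"
    unfolding \<Psi>_def
    by (rule expectation_freeze_history)
       (intro simple_function_add simple_function_mult simple_function_const simple_function_sum
          simple_past_queue simple_function_compose1[OF simple_past_choice] order_refl)
  also have "\<dots> \<le> expectation (\<lambda>s. V * (\<Sum>j=1..Mt. \<theta> j * r 0 j))"
  proof (intro integral_mono simple_integrable simple_function_const)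
    have simple: "simple_function M (\<lambda>s. \<Psi> (Q s t) (m t s) w)" for w
      unfolding \<Psi>_def
      by (intro simple_function_add simple_function_mult simple_function_const simple_function_sum
          simple_queue simple_function_compose1[OF simple_choice])
    show "simple_function M (\<lambda>s. \<Sum>w\<in>event_vectors P. event_prob P w * \<Psi> (Q s t) (m t s) w)"
      by (intro simple_function_sum simple_function_mult simple_function_const simple)
    fix s assume s: "s \<in> space M"
    have frozen: "(\<Sum>w\<in>event_vectors P. event_prob P w * \<Psi> (Q s t) j w)
        = V * r 0 j + (\<Sum>k\<in>K. Q s t k * r k j) - (\<Sum>k\<in>K. Q s t k * target P k)" for j
    proof -
      have "(\<Sum>w\<in>event_vectors P. event_prob P w * \<Psi> (Q s t) j w)
          = V * r 0 j + (\<Sum>k\<in>K. Q s t k * (r k j - target P k * (\<Sum>w\<in>event_vectors P. event_prob P w)))"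
        unfolding \<Psi>_def r_def strategy_penalty_def
        by (simp add: sum.distrib sum_distrib_left sum_distrib_right sum_subtractf algebra_simps
              sum.swap[of _ K "event_vectors P"])
      then show ?thesis
        by (simp add: sum_event_prob algebra_simps sum_subtractf)
    qed
    \<comment> \<open>Only here does the rule of the algorithm enter.\<close>
    have least: "V * r 0 (m t s) + (\<Sum>k\<in>K. Q s t k * r k (m t s))
        \<le> V * r 0 j + (\<Sum>k\<in>K. Q s t k * r k j)" if "j \<in> {1..Mt}" for j
      using choice_minimizes[OF s, of t] that unfolding is_arg_min_linorder virtual_queue_eq r_def by blast
    have nonneg: "0 \<le> \<theta> j" if "j \<in> {1..Mt}" for j
      using \<theta> that by (simp add: lp_feasible_def)
    have sum1: "(\<Sum>j=1..Mt. \<theta> j) = 1"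
      using \<theta> by (simp add: lp_feasible_def)
    have "V * r 0 (m t s) + (\<Sum>k\<in>K. Q s t k * r k (m t s))
        = (\<Sum>j=1..Mt. \<theta> j * (V * r 0 (m t s) + (\<Sum>k\<in>K. Q s t k * r k (m t s))))"
      unfolding sum_distrib_right[symmetric] sum1 by simp
    also have "\<dots> \<le> (\<Sum>j=1..Mt. \<theta> j * (V * r 0 j + (\<Sum>k\<in>K. Q s t k * r k j)))"
      by (intro sum_mono mult_left_mono least nonneg)
    also have "\<dots> = V * (\<Sum>j=1..Mt. \<theta> j * r 0 j) + (\<Sum>k\<in>K. Q s t k * (\<Sum>j=1..Mt. \<theta> j * r k j))"
      by (simp add: distrib_left sum.distrib sum_distrib_left sum.swap[of _ "{1..Mt}"] mult.left_commute
          del: One_nat_def)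
    also have "\<dots> \<le> V * (\<Sum>j=1..Mt. \<theta> j * r 0 j) + (\<Sum>k\<in>K. Q s t k * target P k)"
      using \<theta> by (intro add_left_mono sum_mono mult_left_mono queues.Q_nonneg)
        (auto simp: lp_feasible_def r_def)
    finally show "(\<Sum>w\<in>event_vectors P. event_prob P w * \<Psi> (Q s t) (m t s) w)
        \<le> V * (\<Sum>j=1..Mt. \<theta> j * r 0 j)"
      unfolding frozen by simp
  qed
  finally show ?thesis
    by (simp add: prob_space r_def)
qed

text \<open>
  The first term of \<open>queue_displacement\<close>. It is the same for all outcomes because no penalty has
  arrived by time \<open>D\<close>; this is why it can be taken out of expectations.
\<close>

definition startup_displacement :: "nat \<Rightarrow> real" where
  "startup_displacement t = L2_set (\<lambda>k. queue_rec D (target P k) (Q0 k) (\<lambda>_. 0) D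
     - queue_rec D (target P k) (Q0 k) (\<lambda>_. 0) (min t D)) K"

lemma queue_startup: "t \<le> D \<Longrightarrow> Q s t k = queue_rec D (target P k) (Q0 k) (\<lambda>_. 0) t"
  unfolding queues.Q_def by (rule queue_rec_startup)

lemma startup_displacement_eq: "L2_set (\<lambda>k. Q s D k - Q s (min t D) k) K = startup_displacement t"
  by (simp add: startup_displacement_def queue_startup)

lemma startup_displacement_nonneg: "0 \<le> startup_displacement t"
  by (simp add: startup_displacement_def)

text \<open>
  The expectation of the pathwise drift estimate. Every product of two deviations has mean at most
  \<open>2 B\<close>, and every single deviation has mean at most \<open>sqrt (2 B)\<close>.
\<close>

lemma drift_plus_penalty_step:
  assumes \<theta>: "\<theta> \<in> lp_feasible P g Mt"
  shows "V * expectation (pen 0 t) + (expectation (lyapunov P D Q0 \<omega> \<alpha> (D + Suc t))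
      - expectation (lyapunov P D Q0 \<omega> \<alpha> (D + t)))
    \<le> V * (\<Sum>j=1..Mt. \<theta> j * strategy_penalty P 0 (g j)) + B
      + sqrt (2 * B) * (startup_displacement t + real (min t D) * sqrt (2 * B))"
proof -
  have simple_inner: "simple_function M (\<lambda>s. \<Sum>k\<in>K. Q s t k * (pen k t s - target P k))"
    by (intro simple_function_sum simple_function_compose2[OF simple_queue simple_pen])
  have simple_square: "simple_function M (\<lambda>s. (dev t s)\<^sup>2)"
    by (rule simple_function_compose1[OF simple_dev])
  have simple_product: "simple_function M (\<lambda>s. dev \<tau> s * dev t s)" for \<tau>
    by (intro simple_function_mult simple_dev)
  have pathwise: "lyapunov P D Q0 \<omega> \<alpha> (D + Suc t) s - lyapunov P D Q0 \<omega> \<alpha> (D + t) s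
      \<le> (1/2) * (dev t s)\<^sup>2 + (\<Sum>k\<in>K. Q s t k * (pen k t s - target P k))
        + (startup_displacement t * dev t s + (\<Sum>\<tau>\<in>{t - D..<t}. dev \<tau> s * dev t s))" for s
    using queues.delayed_drift[of s t]
    by (simp add: lyapunov_def virtual_queue_eq startup_displacement_eq[of s] dev_def distrib_right sum_distrib_right)
  have "expectation (lyapunov P D Q0 \<omega> \<alpha> (D + Suc t)) - expectation (lyapunov P D Q0 \<omega> \<alpha> (D + t))
      = expectation (\<lambda>s. lyapunov P D Q0 \<omega> \<alpha> (D + Suc t) s - lyapunov P D Q0 \<omega> \<alpha> (D + t) s)"
    by (intro Bochner_Integration.integral_diff[symmetric] simple_integrable simple_lyapunov)
  also have "\<dots> \<le> expectation (\<lambda>s. (1/2) * (dev t s)\<^sup>2 + (\<Sum>k\<in>K. Q s t k * (pen k t s - target P k))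
        + (startup_displacement t * dev t s + (\<Sum>\<tau>\<in>{t - D..<t}. dev \<tau> s * dev t s)))"
    by (intro integral_mono pathwise Bochner_Integration.integrable_add Bochner_Integration.integrable_diff
        Bochner_Integration.integrable_sum integrable_mult_right simple_integrable
        simple_lyapunov simple_inner simple_square simple_dev simple_product)
  also have "\<dots> = (1/2) * expectation (\<lambda>s. (dev t s)\<^sup>2)
        + expectation (\<lambda>s. \<Sum>k\<in>K. Q s t k * (pen k t s - target P k))
        + (startup_displacement t * expectation (dev t)
          + (\<Sum>\<tau>\<in>{t - D..<t}. expectation (\<lambda>s. dev \<tau> s * dev t s)))"
    using simple_integrable[OF simple_inner] simple_integrable[OF simple_square]
      simple_integrable[OF simple_dev] simple_integrable[OF simple_product] by simp
  also have "\<dots> \<le> B + expectation (\<lambda>s. \<Sum>k\<in>K. Q s t k * (pen k t s - target P k))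
        + (startup_displacement t * sqrt (2 * B) + (\<Sum>\<tau>\<in>{t - D..<t}. 2 * B))"
    using expectation_dev_square[of t]
    by (intro add_mono mult_left_mono sum_mono expectation_dev expectation_dev_product
        startup_displacement_nonneg) auto
  also have "(\<Sum>\<tau>\<in>{t - D..<t}. 2 * B) = real (min t D) * sqrt (2 * B) * sqrt (2 * B)"
    using B_nonneg by (simp add: min_def of_nat_diff)
  finally show ?thesis
    using drift_plus_penalty_le_mixture[OF \<theta>, of t] by (simp add: algebra_simps)
qed

text \<open>
  The sum telescopes from time \<open>D\<close> on, because the penalties of slot \<open>0\<close> enter the queues there.
\<close>

lemma drift_plus_penalty_sum:
  assumes \<theta>: "\<theta> \<in> lp_feasible P g Mt"
  shows "V * (\<Sum>\<tau><t. expectation (pen 0 \<tau>)) + expectation (lyapunov P D Q0 \<omega> \<alpha> (D + t))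
    \<le> real t * (V * (\<Sum>j=1..Mt. \<theta> j * strategy_penalty P 0 (g j)) + B * (1 + 2 * real D))
      + (expectation (lyapunov P D Q0 \<omega> \<alpha> D) + startup_excess P D Q0 B)"
proof -
  let ?\<rho> = "\<Sum>j=1..Mt. \<theta> j * strategy_penalty P 0 (g j)"
  let ?L = "\<lambda>t. expectation (lyapunov P D Q0 \<omega> \<alpha> (D + t))"
  let ?b = "sqrt (2 * B)"
  have "V * (\<Sum>\<tau><t. expectation (pen 0 \<tau>)) + (?L t - ?L 0)
      = (\<Sum>\<tau><t. V * expectation (pen 0 \<tau>) + (?L (Suc \<tau>) - ?L \<tau>))"
    using sum_lessThan_telescope[of ?L t] by (simp add: sum.distrib sum_distrib_left)
  also have "\<dots> \<le> (\<Sum>\<tau><t. V * ?\<rho> + B + ?b * (startup_displacement \<tau> + real (min \<tau> D) * ?b))"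
    by (intro sum_mono drift_plus_penalty_step \<theta>)
  also have "\<dots> = real t * (V * ?\<rho> + B) + (\<Sum>\<tau><t. ?b * (startup_displacement \<tau> + real (min \<tau> D) * ?b))"
    by (simp add: sum.distrib)
  also have "\<dots> \<le> real t * (V * ?\<rho> + B) + (real t * (real D * ?b\<^sup>2)
      + ?b * (\<Sum>j<D. max 0 (startup_displacement j - real (D - j) * ?b)))"
    using B_nonneg by (intro add_left_mono sum_startup_excess_le) (auto simp: startup_displacement_def L2_set_def)
  also have "?b * (\<Sum>j<D. max 0 (startup_displacement j - real (D - j) * ?b)) = startup_excess P D Q0 B"
    by (simp add: startup_excess_def startup_displacement_def min_def)
  also have "?b\<^sup>2 = 2 * B"
    using B_nonneg by simp
  finally show ?thesis
    by (simp add: algebra_simps)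
qed

section \<open>Performance of a run\<close>

lemma lyapunov_nonneg: "0 \<le> lyapunov P D Q0 \<omega> \<alpha> t s"
  by (simp add: lyapunov_def sum_nonneg)

lemma expectation_lyapunov_nonneg: "0 \<le> expectation (lyapunov P D Q0 \<omega> \<alpha> t)"
  by (intro integral_nonneg_AE AE_I2 lyapunov_nonneg)

lemma startup_excess_nonneg: "0 \<le> startup_excess P D Q0 B"
  unfolding startup_excess_def Let_def using B_nonneg by (intro mult_nonneg_nonneg sum_nonneg) auto

lemma avg_objective_bound:
  assumes \<theta>: "\<theta> \<in> lp_feasible P g Mt" and V: "0 < V" and t: "0 < t"
  shows "avg_penalty M P \<omega> \<alpha> 0 t \<le> (\<Sum>j=1..Mt. \<theta> j * strategy_penalty P 0 (g j))
    + (B * (1 + 2 * real D) / V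
       + (expectation (lyapunov P D Q0 \<omega> \<alpha> D) + startup_excess P D Q0 B) / (V * real t))"
proof -
  let ?\<rho> = "\<Sum>j=1..Mt. \<theta> j * strategy_penalty P 0 (g j)"
  let ?l = "expectation (lyapunov P D Q0 \<omega> \<alpha> D) + startup_excess P D Q0 B"
  let ?S = "\<Sum>\<tau><t. expectation (pen 0 \<tau>)"
  have "V * ?S \<le> real t * (V * ?\<rho> + B * (1 + 2 * real D)) + ?l"
    using drift_plus_penalty_sum[OF \<theta>, of t] expectation_lyapunov_nonneg[of "D + t"] by linarith
  then have "V * ?S / (V * real t) \<le> (real t * (V * ?\<rho> + B * (1 + 2 * real D)) + ?l) / (V * real t)"
    using V by (intro divide_right_mono) auto
  also have "\<dots> = ?\<rho> + (B * (1 + 2 * real D) / V + ?l / (V * real t))"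
    using V t by (simp add: add_divide_distrib distrib_left)
  finally show ?thesis
    using V by (simp add: avg_penalty_def)
qed

text \<open>
  A bound for the absolute value of the expected objective of any strategy that the algorithm can choose and of any
  mixture of them.
\<close>

abbreviation "R \<equiv> \<Sum>j=1..Mt. \<bar>strategy_penalty P 0 (g j)\<bar>"

text \<open>
  The objective of the run is at least \<open>- R\<close> and that of the mixture at most \<open>R\<close>, so the penalties
  contribute at most \<open>2 V R\<close> per slot to the growth of the Lyapunov function.
\<close>

lemma expectation_lyapunov_le:
  assumes \<theta>: "\<theta> \<in> lp_feasible P g Mt"
  shows "expectation (lyapunov P D Q0 \<omega> \<alpha> (D + t))
    \<le> real t * (2 * V * R + B * (1 + 2 * real D))
      + (expectation (lyapunov P D Q0 \<omega> \<alpha> D) + startup_excess P D Q0 B)"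
proof -
  let ?\<rho> = "\<Sum>j=1..Mt. \<theta> j * strategy_penalty P 0 (g j)"
  have r_le: "\<bar>strategy_penalty P 0 (g j)\<bar> \<le> R" if "j \<in> {1..Mt}" for j
    using that by (intro member_le_sum) auto
  have "?\<rho> \<le> (\<Sum>j=1..Mt. \<theta> j * R)"
  proof (intro sum_mono mult_left_mono)
    fix j assume j: "j \<in> {1..Mt}"
    show "strategy_penalty P 0 (g j) \<le> R" using r_le[OF j] by linarith
    show "0 \<le> \<theta> j" using \<theta> j by (simp add: lp_feasible_def)
  qed
  also have "\<dots> = R"
    using \<theta> unfolding sum_distrib_right[symmetric] by (simp add: lp_feasible_def)
  finally have \<rho>: "?\<rho> \<le> R" .
  have "- R \<le> expectation (pen 0 \<tau>)" for \<tau>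
  proof -
    have "expectation (\<lambda>s. - R) \<le> expectation (\<lambda>s. strategy_penalty P 0 (g (m \<tau> s)))"
    proof (intro integral_mono simple_integrable simple_function_const simple_function_compose1[OF simple_choice])
      fix s assume "s \<in> space M"
      from r_le[OF choice_range[OF this], of \<tau>] show "- R \<le> strategy_penalty P 0 (g (m \<tau> s))"
        by linarith
    qed
    then show ?thesis by (simp add: expectation_pen prob_space)
  qed
  then have "(\<Sum>\<tau><t. - R) \<le> (\<Sum>\<tau><t. expectation (pen 0 \<tau>))"
    by (intro sum_mono)
  then have "V * (real t * - R) \<le> V * (\<Sum>\<tau><t. expectation (pen 0 \<tau>))"
    using V_nonneg by (intro mult_left_mono) auto
  moreover have "real t * (V * ?\<rho>) \<le> real t * (V * R)"
    using \<rho> V_nonneg by (intro mult_left_mono) auto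
  ultimately show ?thesis
    using drift_plus_penalty_sum[OF \<theta>, of t] by (simp add: algebra_simps)
qed

lemma expectation_queue_le:
  assumes k: "k \<in> K"
  shows "expectation (\<lambda>s. Q s t k) \<le> sqrt (2 * expectation (lyapunov P D Q0 \<omega> \<alpha> t))"
proof (rule expectation_le_of_square[OF simple_queue])
  have "expectation (\<lambda>s. (Q s t k)\<^sup>2) \<le> expectation (\<lambda>s. 2 * lyapunov P D Q0 \<omega> \<alpha> t s)"
  proof (intro integral_mono simple_integrable)
    show "simple_function M (\<lambda>s. (Q s t k)\<^sup>2)"
      by (rule simple_function_compose1[OF simple_queue])
    show "simple_function M (\<lambda>s. 2 * lyapunov P D Q0 \<omega> \<alpha> t s)"
      by (rule simple_function_compose1[OF simple_lyapunov])
    show "(Q s t k)\<^sup>2 \<le> 2 * lyapunov P D Q0 \<omega> \<alpha> t s" for s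
      using member_le_sum[of k K "\<lambda>k. (Q s t k)\<^sup>2"] k by (simp add: lyapunov_def virtual_queue_eq)
  qed
  then show "expectation (\<lambda>s. (Q s t k)\<^sup>2) \<le> (sqrt (2 * expectation (lyapunov P D Q0 \<omega> \<alpha> t)))\<^sup>2"
    using expectation_lyapunov_nonneg[of t] by simp
qed (use expectation_lyapunov_nonneg in simp)

lemma sum_penalty_le_queue:
  assumes k: "k \<in> K"
  shows "(\<Sum>\<tau><t. expectation (pen k \<tau>)) \<le> real t * target P k + expectation (\<lambda>s. Q s (D + t) k)"
proof -
  have "(\<Sum>\<tau><t. expectation (pen k \<tau>)) = expectation (\<lambda>s. \<Sum>\<tau><t. pen k \<tau> s)"
    by (intro Bochner_Integration.integral_sum[symmetric] simple_integrable simple_pen)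
  also have "\<dots> \<le> expectation (\<lambda>s. real t * target P k + Q s (D + t) k)"
  proof (intro integral_mono simple_integrable)
    show "simple_function M (\<lambda>s. \<Sum>\<tau><t. pen k \<tau> s)"
      by (intro simple_function_sum simple_pen)
    show "simple_function M (\<lambda>s. real t * target P k + Q s (D + t) k)"
      by (rule simple_function_compose1[OF simple_queue])
    show "(\<Sum>\<tau><t. pen k \<tau> s) \<le> real t * target P k + Q s (D + t) k" for s
      using queue_rec_ge_sum[of D "target P k" "Q0 k" "\<lambda>\<tau>. pen k \<tau> s" t] queues.Q_nonneg[OF k, of s D]
      by (simp add: queues.Q_def sum_subtractf)
  qed
  also have "\<dots> = real t * target P k + expectation (\<lambda>s. Q s (D + t) k)"
    by (simp add: simple_integrable simple_queue prob_space)
  finally show ?thesis .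
qed

text \<open>
  The Lyapunov value at time \<open>D\<close> written without the run: the constant in the constraint bound must
  not depend on \<open>V\<close> or on how ties are broken.
\<close>

abbreviation "L0 \<equiv> (1/2) * (\<Sum>k\<in>K. (queue_rec D (target P k) (Q0 k) (\<lambda>_. 0) D)\<^sup>2)"

lemma expectation_lyapunov_startup: "expectation (lyapunov P D Q0 \<omega> \<alpha> D) = L0"
proof -
  have "lyapunov P D Q0 \<omega> \<alpha> D = (\<lambda>s. L0)"
    by (rule ext) (simp add: lyapunov_def virtual_queue_eq queue_startup)
  then show ?thesis by (simp add: prob_space)
qed

text \<open>
  The average violation is at most the mean queue divided by \<open>t\<close>. By \<open>expectation_lyapunov_le\<close>
  that queue is of order \<open>sqrt t\<close>; the additive constant is weakened to one multiplied by \<open>t\<close> to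
  get everything under a single root.
\<close>

lemma avg_constraint_bound:
  assumes \<theta>: "\<theta> \<in> lp_feasible P g Mt" and k: "k \<in> K" and t: "1 \<le> t"
  shows "avg_penalty M P \<omega> \<alpha> k t \<le> target P k
    + sqrt (2 * (2 * V * R + (L0 + startup_excess P D Q0 B + B * (1 + 2 * real D))) / real t)"
proof -
  define C where "C = 2 * V * R + B * (1 + 2 * real D)"
  define l where "l = L0 + startup_excess P D Q0 B"
  have l: "0 \<le> l"
    using startup_excess_nonneg by (simp add: l_def sum_nonneg)
  have "expectation (\<lambda>s. Q s (D + t) k) \<le> sqrt (2 * (real t * C + l))"
    using expectation_queue_le[OF k, of "D + t"] expectation_lyapunov_le[OF \<theta>, of t]
    unfolding C_def l_def expectation_lyapunov_startup
    by (meson order_trans real_sqrt_le_mono mult_left_mono zero_le_numeral)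
  also have "\<dots> \<le> sqrt ((real t)\<^sup>2 * (2 * (C + l) / real t))"
  proof (rule real_sqrt_le_mono)
    have "l \<le> real t * l"
      using l t by (simp add: mult_le_cancel_right1)
    then have "2 * (real t * C + l) \<le> 2 * (real t * C + real t * l)"
      by (intro mult_left_mono add_left_mono) auto
    also have "\<dots> = (real t)\<^sup>2 * (2 * (C + l) / real t)"
      using t by (simp add: power2_eq_square field_simps)
    finally show "2 * (real t * C + l) \<le> (real t)\<^sup>2 * (2 * (C + l) / real t)" .
  qed
  also have "\<dots> = real t * sqrt (2 * (C + l) / real t)"
    unfolding real_sqrt_mult[of "(real t)\<^sup>2"] by simp
  finally have "(\<Sum>\<tau><t. expectation (pen k \<tau>)) \<le> real t * (target P k + sqrt (2 * (C + l) / real t))"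
    using sum_penalty_le_queue[OF k, of t] by (simp add: distrib_left)
  then have "avg_penalty M P \<omega> \<alpha> k t \<le> target P k + sqrt (2 * (C + l) / real t)"
    using t by (simp add: avg_penalty_def divide_le_eq mult.commute)
  then show ?thesis
    by (simp add: C_def l_def add_ac)
qed

text \<open>
  For \<open>V \<ge> V0\<close> the terms without \<open>V\<close> are absorbed by enlarging them by the factor \<open>V / V0\<close>.
\<close>

lemma avg_constraint_bound_uniform:
  assumes \<theta>: "\<theta> \<in> lp_feasible P g Mt" and k: "k \<in> K" and t: "1 \<le> t" and V0: "0 < V0" "V0 \<le> V"
  shows "avg_penalty M P \<omega> \<alpha> k t \<le> target P k
    + sqrt (2 * (2 * R + (L0 + startup_excess P D Q0 B + B * (1 + 2 * real D)) / V0)) * sqrt (V / real t)"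
proof -
  define A where "A = L0 + startup_excess P D Q0 B + B * (1 + 2 * real D)"
  have A: "0 \<le> A"
    using startup_excess_nonneg B_nonneg by (simp add: A_def sum_nonneg)
  have "A = A / V0 * V0"
    using V0 by simp
  also have "\<dots> \<le> A / V0 * V"
    using A V0 by (intro mult_left_mono) auto
  finally have "2 * (2 * V * R + A) \<le> 2 * (2 * V * R + A / V0 * V)"
    by (intro mult_left_mono add_left_mono) auto
  also have "\<dots> = 2 * (2 * R + A / V0) * V"
    by (simp add: algebra_simps)
  finally have "2 * (2 * V * R + A) \<le> 2 * (2 * R + A / V0) * V" .
  then have "sqrt (2 * (2 * V * R + A) / real t) \<le> sqrt (2 * (2 * R + A / V0) * V / real t)"
    by (intro real_sqrt_le_mono divide_right_mono) auto
  also have "\<dots> = sqrt (2 * (2 * R + A / V0)) * sqrt (V / real t)"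
    by (simp add: real_sqrt_mult[symmetric] mult.assoc)
  finally show ?thesis
    using avg_constraint_bound[OF \<theta> k t] by (simp add: A_def)
qed

lemma run_meets_constraints:
  assumes \<theta>: "\<theta> \<in> lp_feasible P g Mt"
  shows "meets_constraints M P \<omega> \<alpha>"
  unfolding meets_constraints_def
proof
  fix k assume k: "k \<in> K"
  define A where "A = 2 * (2 * V * R + (L0 + startup_excess P D Q0 B + B * (1 + 2 * real D)))"
  have "(\<lambda>t. sqrt (A / real t)) \<longlonglongrightarrow> sqrt 0"
    by (intro tendsto_real_sqrt lim_const_over_n)
  from tendsto_add[OF tendsto_const[of "target P k"] this]
  have "(\<lambda>t. ereal (target P k + sqrt (A / real t))) \<longlonglongrightarrow> ereal (target P k)"
    by simp
  then have "limsup (\<lambda>t. ereal (target P k + sqrt (A / real t))) = ereal (target P k)"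
    by (intro lim_imp_Limsup) simp_all
  moreover have "limsup (\<lambda>t. ereal (avg_penalty M P \<omega> \<alpha> k t))
      \<le> limsup (\<lambda>t. ereal (target P k + sqrt (A / real t)))"
    using avg_constraint_bound[OF \<theta> k] unfolding A_def
    by (intro Limsup_mono eventually_sequentiallyI[of 1]) simp
  ultimately show "limsup (\<lambda>t. ereal (avg_penalty M P \<omega> \<alpha> k t)) \<le> ereal (target P k)"
    by simp
qed

text \<open>
  The common information is the index of the chosen strategy, encoded in the prescribed type by an
  injection of the natural numbers.
\<close>

lemma run_distributed:
  assumes g: "g ` {1..Mt} \<subseteq> pure_strategies P" and inf: "infinite (UNIV :: 'x set)"
  shows "distributed_alg TYPE('x) M P \<omega> \<alpha>"
proof -
  obtain e :: "nat \<Rightarrow> 'x" where e: "inj e"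
    using infinite_countable_subset[OF inf] by blast
  let ?X = "count_space (e ` {1..Mt})"
  show ?thesis
    unfolding distributed_alg_def
  proof (intro exI[of _ ?X] exI[of _ "\<lambda>t s. e (m t s)"] exI[of _ "\<lambda>i w x. g (inv e x) i w"]
      conjI allI ballI)
    fix t :: nat
    have "(\<lambda>h. e (snd h t)) \<in> history_space t \<rightarrow>\<^sub>M ?X"
      by (rule measurable_compose[OF past_choice_measurable[OF order_refl]]) auto
    from indep_rv_compose[OF event_fresh measurable_ident this]
    show "indep_rv M (count_space (event_vectors P)) (\<omega> t) ?X (\<lambda>s. e (m t s))"
      by simp
  next
    fix i w assume "i \<in> {1..n_users P}" "w \<in> event_set P i"
    then have "g j i w \<in> action_set P i" if "j \<in> {1..Mt}" for j
      using g that by (auto simp: pure_strategies_def PiE_iff image_subset_iff)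
    then show "(\<lambda>x. g (inv e x) i w) \<in> ?X \<rightarrow>\<^sub>M count_space (action_set P i)"
      using e by auto
  next
    fix t s assume "s \<in> space M"
    then show "\<alpha> t s = (\<lambda>i\<in>{1..n_users P}. g (inv e (e (m t s))) i (\<omega> t s i))"
      using e by (simp add: action apply_strategy_def)
  qed
qed

end

section \<open>The performance theorem\<close>

theorem theorem3:
  fixes P :: "('w, 'a) scheduling_problem"
    and M :: "'s measure"
    and \<omega> :: "nat \<Rightarrow> 's \<Rightarrow> nat \<Rightarrow> 'w"
    and g :: "nat \<Rightarrow> nat \<Rightarrow> 'w \<Rightarrow> 'a"
    and Mt D :: nat
    and Q0 :: "nat \<Rightarrow> real"
  assumes "finite_alphabets P"
    and "iid_events M P \<omega>"
    and "strategy_enumeration P g Mt"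
    and "\<forall>k\<in>{1..n_constraints P}. Q0 k \<ge> 0"
    and "infinite (UNIV :: 'x set)"
    and "feasible_problem TYPE('x) M P \<omega>"
  shows "(\<forall>V\<ge>0. \<forall>\<alpha>. drift_plus_penalty M P \<omega> g Mt D Q0 V \<alpha> \<longrightarrow>
            meets_constraints M P \<omega> \<alpha> \<and> distributed_alg TYPE('x) M P \<omega> \<alpha>) \<and>
         (\<forall>V>0. \<forall>\<alpha>. drift_plus_penalty M P \<omega> g Mt D Q0 V \<alpha> \<longrightarrow>
            (\<forall>t>0. ereal (avg_penalty M P \<omega> \<alpha> 0 t)
               \<le> p0_opt TYPE('x) M P \<omega>
                 + ereal (drift_const P g Mt * (1 + 2 * real D) / V
                     + ((\<integral>s. lyapunov P D Q0 \<omega> \<alpha> D s \<partial>M)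
                         + startup_excess P D Q0 (drift_const P g Mt)) / (V * real t)))) \<and>
         (\<forall>V0>0. \<exists>\<Gamma>. \<forall>V\<ge>V0. \<forall>\<alpha>. drift_plus_penalty M P \<omega> g Mt D Q0 V \<alpha> \<longrightarrow>
            (\<forall>t\<ge>1. \<forall>k\<in>{1..n_constraints P}.
               avg_penalty M P \<omega> \<alpha> k t \<le> target P k + \<Gamma> * sqrt (V / real t)))"
proof -
  interpret event_system M P \<omega>
    using assms(1,2) by (auto simp: event_system_def event_system_axioms_def iid_events_def)
  have bij: "bij_betw g {1..n_strategies P} (pure_strategies P)" and Mt: "Mt \<le> n_strategies P"
    and val: "lp_value P g Mt = lp_value P g (n_strategies P)"
    using assms(3) by (auto simp: strategy_enumeration_def)
  have pure: "g ` {1..Mt} \<subseteq> pure_strategies P"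
    using bij Mt by (auto simp: bij_betw_def)
  obtain \<theta> where \<theta>: "\<theta> \<in> lp_feasible P g Mt"
    using lp_feasible_nonempty[OF assms(3,6)] by blast
  have run: "\<exists>m. drift_plus_penalty_run M P \<omega> g Mt D Q0 V \<alpha> m"
    if "drift_plus_penalty M P \<omega> g Mt D Q0 V \<alpha>" "0 \<le> V" for V \<alpha>
    using that assms(4) event_system_axioms
    unfolding drift_plus_penalty_def drift_plus_penalty_run_def drift_plus_penalty_run_axioms_def
    by blast
  show ?thesis
  proof (intro conjI allI impI)
    fix V :: real and \<alpha> assume "0 \<le> V" "drift_plus_penalty M P \<omega> g Mt D Q0 V \<alpha>"
    with run obtain m where "drift_plus_penalty_run M P \<omega> g Mt D Q0 V \<alpha> m" by blast
    then interpret drift_plus_penalty_run M P \<omega> g Mt D Q0 V \<alpha> m .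
    show "meets_constraints M P \<omega> \<alpha>" by (rule run_meets_constraints[OF \<theta>])
    show "distributed_alg TYPE('x) M P \<omega> \<alpha>" by (rule run_distributed[OF pure assms(5)])
  next
    fix V :: real and \<alpha> and t :: nat
    assume V: "0 < V" and "drift_plus_penalty M P \<omega> g Mt D Q0 V \<alpha>" and t: "0 < t"
    with run obtain m where "drift_plus_penalty_run M P \<omega> g Mt D Q0 V \<alpha> m" by fastforce
    then interpret drift_plus_penalty_run M P \<omega> g Mt D Q0 V \<alpha> m .
    let ?c = "B * (1 + 2 * real D) / V
       + (expectation (lyapunov P D Q0 \<omega> \<alpha> D) + startup_excess P D Q0 B) / (V * real t)"
    \<comment> \<open>The bound holds for every feasible mixture, so the infimum over mixtures
      satisfies it whether or not it is attained.\<close>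
    have "ereal (avg_penalty M P \<omega> \<alpha> 0 t - ?c) \<le> lp_value P g Mt"
      unfolding lp_value_def using avg_objective_bound[OF _ V t]
      by (intro INF_greatest) (simp add: algebra_simps)
    also have "\<dots> \<le> p0_opt TYPE('x) M P \<omega>"
      unfolding val by (rule lp_value_le_p0_opt[OF bij])
    finally show "ereal (avg_penalty M P \<omega> \<alpha> 0 t) \<le> p0_opt TYPE('x) M P \<omega> + ereal ?c"
      by (cases "p0_opt TYPE('x) M P \<omega>") (auto simp: algebra_simps)
  next
    fix V0 :: real assume V0: "0 < V0"
    show "\<exists>\<Gamma>. \<forall>V\<ge>V0. \<forall>\<alpha>. drift_plus_penalty M P \<omega> g Mt D Q0 V \<alpha> \<longrightarrow>
            (\<forall>t\<ge>1. \<forall>k\<in>{1..n_constraints P}.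
               avg_penalty M P \<omega> \<alpha> k t \<le> target P k + \<Gamma> * sqrt (V / real t))"
    proof (intro exI allI impI ballI)
      fix V :: real and \<alpha> and t k :: nat
      assume V: "V0 \<le> V" and "drift_plus_penalty M P \<omega> g Mt D Q0 V \<alpha>"
        and t: "1 \<le> t" and k: "k \<in> {1..n_constraints P}"
      with run V0 obtain m where "drift_plus_penalty_run M P \<omega> g Mt D Q0 V \<alpha> m" by fastforce
      then show "avg_penalty M P \<omega> \<alpha> k t \<le> target P k
        + sqrt (2 * (2 * (\<Sum>j=1..Mt. \<bar>strategy_penalty P 0 (g j)\<bar>)
            + ((1/2) * (\<Sum>k=1..n_constraints P. (queue_rec D (target P k) (Q0 k) (\<lambda>_. 0) D)\<^sup>2)
               + startup_excess P D Q0 (drift_const P g Mt)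
               + drift_const P g Mt * (1 + 2 * real D)) / V0)) * sqrt (V / real t)"
        by (rule drift_plus_penalty_run.avg_constraint_bound_uniform[OF _ \<theta> k t V0 V])
    qed
  qed
qed

end
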